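(* Let $d,r,n$ be integers satisfying $d\geqslant 3$, $r\leqslant d-2$ (in particular, $r$ may be negative), and $n\geqslant d-r$, such that $d$ and $r$ are coprime, and $n\equiv -r\pmod{d}$. Then $$\sum_{k=0}^{n-1}[2dk+r]\frac{(q^r;q^d)_k^{2d}}{(q^d;q^d)_k^{2d}}\,q^{d(d-1-r)k}\equiv 0\pmod{\Phi_n(q)^4}.$$
   Context: Here $q$ is an indeterminate. The $q$-shifted factorial is $(a;q)_k=(1-a)(1-aq)\cdots(1-aq^{k-1})$, with $(a;q)_0=1$; thus $(q^r;q^d)_k=\prod_{j=0}^{k-1}(1-q^{r+dj})$. The $q$-integer is $[m]=[m]_q=\frac{1-q^m}{1-q}$ for any integer $m$ (so $[m]=1+q+\cdots+q^{m-1}$ for $m\geqslant 1$). $\Phi_n(q)=\prod_{1\leqslant k\leqslant n,\ \gcd(n,k)=1}(q-\zeta^k)$, with $\zeta$ a primitive $n$-th root of unity, is the $n$-th cyclotomic polynomial. For rational functions $A(q),B(q)\in\mathbb{Q}(q)$ and a polynomial $P(q)$, the congruence $A(q)\equiv B(q)\pmod{P(q)}$ means that $P(q)$ divides the numerator of $A(q)-B(q)$ written in lowest terms, as polynomials in $q$ over $\mathbb{Q}$. *)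

theory Defs
  imports
    "HOL-Computational_Algebra.Computational_Algebra"
    "HOL-Computational_Algebra.Field_as_Ring"
    "HOL-Number_Theory.Cong"
begin

definition q_var :: "rat poly fract" where
  "q_var = to_fract [:0, 1:]"

definition q_shifted_factorial :: "'a::field \<Rightarrow> 'a \<Rightarrow> nat \<Rightarrow> 'a" where
  "q_shifted_factorial a q k = (\<Prod>j<k. 1 - a * q ^ j)"

definition q_integer :: "'a::field \<Rightarrow> int \<Rightarrow> 'a" where
  "q_integer q m = (1 - q powi m) / (1 - q)"

definition cyclotomic_complex :: "nat \<Rightarrow> complex poly" where
  "cyclotomic_complex n =
     (\<Prod>k | 1 \<le> k \<and> k \<le> n \<and> coprime n k. [:- (cis (2 * pi / real n) ^ k), 1:])"

text \<open>The same polynomial, regarded as a polynomial over the rationals; that the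
  description denotes is lemma \<open>of_rat_cyclotomic\<close> below.\<close>

definition cyclotomic :: "nat \<Rightarrow> rat poly" where
  "cyclotomic n = (THE p. map_poly of_rat p = cyclotomic_complex n)"

text \<open>\<^const>\<open>quot_of_fract\<close> yields the coprime numerator/denominator pair with monic
  denominator, so its first component is the numerator in lowest terms.\<close>

definition fract_cong :: "rat poly fract \<Rightarrow> rat poly fract \<Rightarrow> rat poly \<Rightarrow> bool" where
  "fract_cong A B P \<longleftrightarrow> P dvd fst (quot_of_fract (A - B))"

lemma map_poly_of_rat_add:
  "map_poly of_rat (p + q) = (map_poly of_rat p + map_poly of_rat q :: 'a::field_char_0 poly)"
  by (intro poly_eqI) (simp add: coeff_map_poly of_rat_add)

lemma map_poly_of_rat_mult:
  "map_poly of_rat (p * q) = (map_poly of_rat p * map_poly of_rat q :: 'a::field_char_0 poly)"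
  by (intro poly_eqI) (simp add: coeff_map_poly coeff_mult of_rat_sum of_rat_mult)

lemma map_poly_of_rat_prod:
  "map_poly of_rat (prod f A) = (\<Prod>x\<in>A. map_poly of_rat (f x) :: 'a::field_char_0 poly)"
  by (induction A rule: infinite_finite_induct) (simp_all add: map_poly_of_rat_mult)

lemma inj_map_poly_of_rat:
  "map_poly of_rat p = (map_poly of_rat q :: 'a::field_char_0 poly) \<Longrightarrow> p = q"
  by (simp add: poly_eq_iff coeff_map_poly)

lemma degree_map_poly_of_rat [simp]:
  "degree (map_poly of_rat p :: 'a::field_char_0 poly) = degree p"
  by (intro degree_map_poly) simp

lemma monom_minus_1_eq_prod_roots:
  assumes "n > 0"
  shows "monom 1 n - 1 = (\<Prod>k\<in>{1..n}. [:- (cis (2 * pi / real n) ^ k), 1:])"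
proof -
  let ?p = "monom 1 n - 1 :: complex poly"
  have deg: "degree ?p = n"
    using assms by (subst diff_conv_add_uminus, subst degree_add_eq_left)
      (auto simp: degree_monom_eq)
  have lc: "lead_coeff ?p = 1"
    unfolding deg using assms by simp
  have "rsquarefree ?p"
    unfolding rsquarefree_roots
    using assms by (auto simp: pderiv_monom pderiv_diff poly_monom power_0_left)
  from complex_poly_decompose_rsquarefree[OF this]
  have "?p = (\<Prod>z | z ^ n = 1. [:- z, 1:])"
    by (simp only: lc smult_1_left) (simp add: poly_monom)
  also have "\<dots> = (\<Prod>k<n. [:- cis (2 * pi * real k / real n), 1:])"
    using prod.reindex_bij_betw[OF bij_betw_roots_unity[OF assms], of "\<lambda>z. [:- z, 1:]"] by simp
  also have "\<dots> = (\<Prod>k<n. [:- (cis (2 * pi / real n) ^ k), 1:])"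
    by (simp add: Complex.DeMoivre mult_ac)
  also have "\<dots> = (\<Prod>k\<in>{1..n}. [:- (cis (2 * pi / real n) ^ k), 1:])"
  proof -
    have "cis (2 * pi / real n) ^ n = 1"
      using assms by (simp add: Complex.DeMoivre)
    then show ?thesis
      using assms
      by (intro prod.reindex_bij_witness[of _ "\<lambda>k. if k = n then 0 else k" "\<lambda>k. if k = 0 then n else k"])
        auto
  qed
  finally show ?thesis .
qed

lemma monom_minus_1_eq_prod_cyclotomic_complex:
  assumes "n > 0"
  shows "monom 1 n - 1 = (\<Prod>e | e dvd n. cyclotomic_complex e)"
proof -
  let ?S = "SIGMA e : {e. e dvd n}. {k. 1 \<le> k \<and> k \<le> e \<and> coprime e k}"
  have "(\<Prod>e | e dvd n. cyclotomic_complex e) =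
      (\<Prod>(e, k)\<in>?S. [:- (cis (2 * pi / real e) ^ k), 1:])"
    unfolding cyclotomic_complex_def using assms by (subst prod.Sigma) auto
  also have "\<dots> = (\<Prod>k\<in>{1..n}. [:- (cis (2 * pi / real n) ^ k), 1:])"
  proof (rule prod.reindex_bij_witness[of _ "\<lambda>k. (n div gcd n k, k div gcd n k)" "\<lambda>(e, k). k * (n div e)"])
    fix x assume x: "x \<in> ?S"
    then obtain e k where [simp]: "x = (e, k)" and ek: "e dvd n" "1 \<le> k" "k \<le> e" "coprime e k"
      by auto
    from ek(1) obtain m where m: "n = e * m" by blast
    with assms have pos: "e > 0" "m > 0" by auto
    have g: "gcd (e * m) (k * m) = m"
      using ek(4) gcd_mult_distrib_nat[of m e k] by (simp add: mult.commute)
    show "(n div gcd n (case x of (e, k) \<Rightarrow> k * (n div e)),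
        (case x of (e, k) \<Rightarrow> k * (n div e)) div gcd n (case x of (e, k) \<Rightarrow> k * (n div e))) = x"
      using pos g by (simp add: m)
    show "(case x of (e, k) \<Rightarrow> k * (n div e)) \<in> {1..n}"
      using pos ek by (simp add: m)
    show "[:- (cis (2 * pi / real n) ^ (case x of (e, k) \<Rightarrow> k * (n div e))), 1:] =
        (case x of (e, k) \<Rightarrow> [:- (cis (2 * pi / real e) ^ k), 1:])"
    proof -
      have "real (k * m) * (2 * pi / real (e * m)) = real k * (2 * pi / real e)"
        using pos by simp
      then have "cis (2 * pi / real (e * m)) ^ (k * m) = cis (2 * pi / real e) ^ k"
        by (simp only: Complex.DeMoivre)
      moreover have "(e * m) div e = m" using pos by simp
      ultimately show ?thesis
        by (simp only: m \<open>x = (e, k)\<close> prod.case)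
    qed
  next
    fix k assume k: "k \<in> {1..n}"
    define g where "g = gcd n k"
    have "gcd n k \<noteq> 0" using assms by simp
    from gcd_coprime_exists[OF this]
    obtain a b where ab: "n = a * g" "k = b * g" "coprime a b"
      unfolding g_def by blast
    from ab(1,2) have pos: "g > 0" "a > 0" "b > 0" using assms k by (auto intro!: Nat.gr0I)
    show "(case (n div gcd n k, k div gcd n k) of (e, k) \<Rightarrow> k * (n div e)) = k"
      unfolding g_def[symmetric] using pos by (simp add: ab)
    show "(n div gcd n k, k div gcd n k) \<in> ?S"
      unfolding g_def[symmetric] using pos ab k by (auto simp: Suc_le_eq)
  qed
  finally show ?thesis
    using monom_minus_1_eq_prod_roots[OF assms] by simp
qed

lemma cyclotomic_complex_rational:
  "\<exists>p. map_poly of_rat p = cyclotomic_complex n"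
proof (induction n rule: less_induct)
  case (less n)
  show ?case
  proof (cases "n = 0")
    case True
    then have "{k. 1 \<le> k \<and> k \<le> n \<and> coprime n k} = {}" by auto
    then have "cyclotomic_complex n = 1"
      unfolding cyclotomic_complex_def by (simp only: prod.empty)
    then show ?thesis by (intro exI[of _ 1]) simp
  next
    case False
    let ?D = "{e. e dvd n \<and> e \<noteq> n}"
    have lt: "e < n" if "e \<in> ?D" for e
      using that False by (auto dest: dvd_imp_le)
    then obtain P where P: "\<And>e. e \<in> ?D \<Longrightarrow> map_poly of_rat (P e) = cyclotomic_complex e"
      using less by metis
    define Q where "Q = prod P ?D"
    define F where "F = (monom 1 n - 1 :: rat poly)"
    have D: "{e. e dvd n} = insert n ?D" "finite ?D" using False by auto
    have Q: "map_poly of_rat Q = prod cyclotomic_complex ?D"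
      unfolding Q_def map_poly_of_rat_prod by (intro prod.cong) (auto simp: P)
    have "Q \<noteq> 0"
    proof
      assume "Q = 0"
      with Q have "prod cyclotomic_complex ?D = 0" by simp
      then show False using D(2) by (auto simp: cyclotomic_complex_def)
    qed
    have "map_poly of_rat F = (monom 1 n - 1 :: complex poly)"
      unfolding F_def by (intro poly_eqI) (simp add: coeff_map_poly of_rat_diff)
    also have "\<dots> = cyclotomic_complex n * map_poly of_rat Q"
      using monom_minus_1_eq_prod_cyclotomic_complex[of n] False D by (simp add: Q)
    finally have F: "map_poly of_rat F = cyclotomic_complex n * map_poly of_rat Q" .
    have "map_poly of_rat F =
        map_poly of_rat (F div Q) * map_poly of_rat Q + (map_poly of_rat (F mod Q) :: complex poly)"
      by (simp flip: map_poly_of_rat_mult map_poly_of_rat_add)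
    with F have eq: "(cyclotomic_complex n - map_poly of_rat (F div Q)) * map_poly of_rat Q =
        map_poly of_rat (F mod Q)"
      by (simp add: algebra_simps)
    have "cyclotomic_complex n - map_poly of_rat (F div Q) = 0"
    proof (rule ccontr)
      assume nz: "cyclotomic_complex n - map_poly of_rat (F div Q) \<noteq> 0"
      have Q0: "map_poly of_rat Q \<noteq> (0 :: complex poly)"
        using \<open>Q \<noteq> 0\<close> inj_map_poly_of_rat[of Q 0] by auto
      from nz Q0 have "degree (map_poly of_rat (F mod Q) :: complex poly) =
          degree (cyclotomic_complex n - map_poly of_rat (F div Q)) + degree Q"
        using degree_mult_eq[OF nz Q0] unfolding eq by (simp only: degree_map_poly_of_rat)
      then have "degree Q \<le> degree (F mod Q)" by simp
      moreover have "F mod Q \<noteq> 0"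
        using nz Q0 eq by auto
      ultimately show False
        using degree_mod_less[OF \<open>Q \<noteq> 0\<close>, of F] by simp
    qed
    then show ?thesis by (intro exI[of _ "F div Q"]) simp
  qed
qed

lemma of_rat_cyclotomic: "map_poly of_rat (cyclotomic n) = cyclotomic_complex n"
proof -
  obtain p where p: "map_poly of_rat p = cyclotomic_complex n"
    using cyclotomic_complex_rational by blast
  show ?thesis unfolding cyclotomic_def
    by (rule theI[of _ p]) (use p in \<open>auto intro: inj_map_poly_of_rat[where 'a = complex]\<close>)
qed

end

theory Submission
  imports Defs
begin

text \<open>
  Put \<open>a = q ^ r\<close> and \<open>Q = q ^ d\<close>. The summand is very-well-poised: besides \<open>1 - a Q ^ (2 k)\<close> and a
  power of \<open>q\<close> it consists of \<open>2 d\<close> equal quotients \<open>(a; Q)\<^sub>k / (Q; Q)\<^sub>k\<close>. The sum is embedded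
  into a family: for a list \<open>c\<close> of \<open>2 d\<close> integers let \<open>F c\<close> be the sum obtained, apart from the
  factor \<open>1 / (1 - q)\<close>, when the quotients are replaced by
  \<open>(a q ^ (n c\<^sub>i); Q)\<^sub>k / (Q q ^ (- n c\<^sub>i); Q)\<^sub>k\<close>. The given sum is the value at \<open>c = 0\<close>, and it is
  recovered from exact zeros of \<open>F\<close>.

  Exact zeros. Let \<open>M\<close> be given by \<open>r + d M = (d - 1) n\<close>. For the exponents
  \<open>0, 1 - d, s\<^sub>1, 1 - s\<^sub>1, \<dots>, s\<^sub>d\<^sub>-\<^sub>1, 1 - s\<^sub>d\<^sub>-\<^sub>1\<close> the second parameter is \<open>Q ^ (- M)\<close>, so the sum
  terminates, and each pair \<open>s, 1 - s\<close> contributes a polynomial in \<open>Q ^ (- k) + a Q ^ k\<close>. The sum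
  is then a divided difference of order \<open>M\<close> of a polynomial whose degree is less than \<open>M\<close>
  because \<open>r \<le> d - 2\<close>, hence 0 for all integers \<open>s\<^sub>i\<close>
  (\<open>karlsson_minton_well_poised_sum_zero\<close>, \<open>sum_deformed_term_vanishing_point\<close>).

  Expansion. Near a primitive \<open>n\<close>-th root of unity \<open>\<zeta>\<close> put \<open>q = \<zeta> exp h\<close>; then \<open>q ^ (n c) = exp (n c h)\<close>.
  The terms with \<open>k > M\<close> are divisible by \<open>h ^ (2 d)\<close>. For \<open>k \<le> M\<close> the logarithm of a quotient is a
  power series in \<open>c h\<close> whose coefficients are power series in \<open>h\<close>. So if the exponents have sum 0,
  then modulo \<open>h ^ 4\<close> the value \<open>F c\<close> is \<open>A + p\<^sub>2 B + p\<^sub>3 h ^ 3 C\<close> with the power sums \<open>p\<^sub>2, p\<^sub>3\<close> of \<open>c\<close>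
  and with power series \<open>A, B, C\<close> in \<open>h\<close> that are independent of \<open>c\<close>.
  At \<open>h = 0\<close> the reversal \<open>k \<mapsto> M - k\<close> changes the sign of each undeformed term and preserves the cubic
  logarithmic coefficient, so \<open>h\<close> divides \<open>C\<close> and the cubic term disappears
  (\<open>sum_term_series_expansion\<close>).

  Conclusion. Two exact zeros with different \<open>p\<^sub>2\<close> force \<open>A\<close> and \<open>B\<close> to vanish modulo \<open>h ^ 4\<close>, and \<open>A\<close> is
  the value at \<open>c = 0\<close>. As this holds at every primitive \<open>n\<close>-th root of unity, the numerator is
  divisible by the fourth power of the cyclotomic polynomial (\<open>fract_cong_0_cyclotomic_power\<close>).
\<close>

section \<open>A very-well-poised sum that vanishes by interpolation\<close>

text \<open>
  The sum is the coefficient of \<open>X ^ M\<close> in the Lagrange interpolant of \<open>p\<close> at the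
  \<open>M + 1\<close> nodes \<open>x 0, \<dots>, x M\<close>, and the interpolant of a polynomial of degree at most \<open>M\<close> is
  that polynomial itself.
\<close>

lemma lagrange_weights_annihilate:
  fixes x :: "nat \<Rightarrow> 'a::field"
  assumes inj: "inj_on x {..M}" and deg: "degree p < M"
  shows "(\<Sum>k\<le>M. poly p (x k) / (\<Prod>j\<in>{..M} - {k}. x k - x j)) = 0"
proof -
  define w where "w k = (\<Prod>j\<in>{..M} - {k}. x k - x j)" for k
  define b where "b k = (\<Prod>j\<in>{..M} - {k}. [:- x j, 1:])" for k
  define L where "L = (\<Sum>k\<le>M. smult (poly p (x k) / w k) (b k))"
  have deg_b: "degree (b k) = M" if "k \<le> M" for k
    unfolding b_def using that by (subst degree_prod_eq_sum_degree) auto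
  have lc_b: "coeff (b k) M = 1" if "k \<le> M" for k
  proof -
    have "lead_coeff (b k) = (\<Prod>j\<in>{..M} - {k}. lead_coeff [:- x j, 1:])"
      unfolding b_def by (rule lead_coeff_prod)
    then show ?thesis using deg_b[OF that] by simp
  qed
  have w: "w k \<noteq> 0" if "k \<le> M" for k
    using that inj by (auto simp: w_def inj_on_def)
  have b_at: "poly (b k) (x i) = (if i = k then w k else 0)" if "k \<le> M" "i \<le> M" for i k
    using that by (auto simp: b_def w_def poly_prod)
  have "poly L (x i) = poly p (x i)" if "i \<le> M" for i
  proof -
    have "poly L (x i) = (\<Sum>k\<le>M. if k = i then poly p (x i) else 0)"
      unfolding L_def poly_sum using that w by (intro sum.cong) (auto simp: b_at)
    then show ?thesis using that by simp
  qed
  moreover have "degree L \<le> M"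
    unfolding L_def by (intro degree_sum_le order.trans[OF degree_smult_le]) (auto simp: deg_b)
  ultimately have "L = p"
    using inj deg by (intro poly_eqI_degree[of "x ` {..M}"]) (auto simp: card_image)
  then have "coeff L M = 0"
    using deg by (simp add: coeff_eq_0)
  then show ?thesis
    by (simp add: L_def coeff_sum lc_b w_def)
qed

lemma q_shifted_factorial_add:
  "q_shifted_factorial a q (k + l) = q_shifted_factorial a q k * q_shifted_factorial (a * q ^ k) q l"
  by (induction l) (simp_all add: q_shifted_factorial_def power_add mult_ac)

lemma q_shifted_factorial_nonzero:
  "(\<And>j. j < k \<Longrightarrow> a * q ^ j \<noteq> 1) \<Longrightarrow> q_shifted_factorial a q k \<noteq> 0"
  by (auto simp: q_shifted_factorial_def)

lemma well_poised_node_diff: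
  fixes a Q :: "'a::field"
  assumes "Q \<noteq> 0"
  shows "(1 / Q ^ k + a * Q ^ k) - (1 / Q ^ j + a * Q ^ j)
    = (1 - Q ^ k / Q ^ j) * (1 - a * Q ^ k * Q ^ j) / Q ^ k"
  using assms by (simp add: field_simps)

text \<open>
  Why very-well-poised sums are interpolation formulas: up to a factor that does not depend
  on \<open>k\<close>, the core of a terminating very-well-poised term is the Lagrange weight of the node
  \<open>X k = Q ^ (- k) + a Q ^ k\<close>. The factorisation of \<open>X k - X j\<close> puts the factors with \<open>j < k\<close> into
  \<open>(Q; Q)\<^sub>k\<close>, those with \<open>j > k\<close> into \<open>(Q ^ (- M); Q)\<^sub>k\<close>, and the factors \<open>1 - a Q ^ (k + j)\<close>
  into the two remaining factorials.
\<close>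

lemma well_poised_lagrange_weight:
  fixes a Q :: "'a::field" and M :: nat
  defines "X \<equiv> \<lambda>k. 1 / Q ^ k + a * Q ^ k"
  assumes Q: "Q \<noteq> 0" "\<And>j. 0 < j \<Longrightarrow> j \<le> M \<Longrightarrow> Q ^ j \<noteq> 1"
    and a: "\<And>j. j \<le> 2 * M \<Longrightarrow> a * Q ^ j \<noteq> 1"
    and k: "k \<le> M"
  shows "(1 - a * Q ^ (2 * k)) *
      (q_shifted_factorial a Q k / q_shifted_factorial Q Q k) *
      (q_shifted_factorial (1 / Q ^ M) Q k / q_shifted_factorial (a * Q ^ Suc M) Q k) * Q ^ (k * M)
    = q_shifted_factorial (1 / Q ^ M) Q M * q_shifted_factorial a Q (Suc M) /
      (\<Prod>j\<in>{..M} - {k}. X k - X j)"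
proof -
  define A where "A = (\<Prod>j\<in>{..M} - {k}. 1 - a * Q ^ k * Q ^ j)"
  define B where "B = (\<Prod>j\<in>{k<..M}. 1 - Q ^ k / Q ^ j)"
  have split: "{..M} - {k} = {..<k} \<union> {k<..M}" using k by auto
  have "(\<Prod>j\<in>{..M} - {k}. X k - X j)
      = (\<Prod>j\<in>{..M} - {k}. (1 - Q ^ k / Q ^ j) * (1 - a * Q ^ k * Q ^ j) / Q ^ k)"
    unfolding X_def by (intro prod.cong refl well_poised_node_diff Q)
  also have "\<dots> = (\<Prod>j\<in>{..M} - {k}. 1 - Q ^ k / Q ^ j) * A / Q ^ (k * M)"
    using k by (simp add: prod_dividef prod.distrib A_def power_mult)
  also have "(\<Prod>j\<in>{..M} - {k}. 1 - Q ^ k / Q ^ j) = (\<Prod>j<k. 1 - Q ^ k / Q ^ j) * B"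
    unfolding split B_def by (intro prod.union_disjoint) auto
  also have "(\<Prod>j<k. 1 - Q ^ k / Q ^ j) = q_shifted_factorial Q Q k"
  proof -
    have "Q * Q ^ (k - Suc j) = Q ^ k / Q ^ j" if "j < k" for j
      using that Q(1) by (simp add: power_diff)
    then show ?thesis
      unfolding q_shifted_factorial_def
      by (intro prod.reindex_bij_witness[of _ "\<lambda>j. k - Suc j" "\<lambda>j. k - Suc j"]) auto
  qed
  finally have den: "(\<Prod>j\<in>{..M} - {k}. X k - X j)
      = q_shifted_factorial Q Q k * B * A / Q ^ (k * M)" .
  have fa: "q_shifted_factorial a Q (Suc M) * q_shifted_factorial (a * Q ^ Suc M) Q k
      = q_shifted_factorial a Q k * ((1 - a * Q ^ (2 * k)) * A)"
  proof -
    have "q_shifted_factorial (a * Q ^ k) Q (Suc M) = (\<Prod>j\<le>M. 1 - a * Q ^ k * Q ^ j)"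
      unfolding q_shifted_factorial_def by (simp add: lessThan_Suc_atMost)
    also have "\<dots> = (1 - a * Q ^ k * Q ^ k) * A"
      unfolding A_def using k by (intro prod.remove) auto
    finally show ?thesis
      using q_shifted_factorial_add[of a Q "Suc M" k] q_shifted_factorial_add[of a Q k "Suc M"]
      by (simp add: add.commute mult_2 power_add mult.assoc)
  qed
  have fM: "q_shifted_factorial (1 / Q ^ M) Q M = q_shifted_factorial (1 / Q ^ M) Q k * B"
  proof -
    have "q_shifted_factorial (1 / Q ^ M * Q ^ k) Q (M - k) = B"
      unfolding q_shifted_factorial_def B_def using Q k
      by (intro prod.reindex_bij_witness[of _ "\<lambda>j. M - j" "\<lambda>j. M - j"])
         (auto simp: power_diff field_simps simp flip: power_add)
    then show ?thesis
      using q_shifted_factorial_add[of "1 / Q ^ M" Q k "M - k"] k by simp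
  qed
  have "q_shifted_factorial (a * Q ^ Suc M) Q k \<noteq> 0"
    using a[of "Suc M + _"] k
    by (intro q_shifted_factorial_nonzero) (auto simp: mult.assoc simp flip: power_add power_Suc)
  moreover have "q_shifted_factorial Q Q k \<noteq> 0"
    using Q k by (intro q_shifted_factorial_nonzero) (auto simp flip: power_Suc)
  moreover have "A \<noteq> 0"
  proof -
    have "a * Q ^ k * Q ^ j \<noteq> 1" if "j \<le> M" for j
      using a[of "k + j"] k that by (simp add: power_add mult.assoc)
    then show ?thesis by (auto simp: A_def)
  qed
  moreover have "B \<noteq> 0"
  proof -
    have "Q ^ k \<noteq> Q ^ j" if "k < j" "j \<le> M" for j
    proof -
      have "Q ^ (j - k) \<noteq> 1" using Q(2) that by simp
      then show ?thesis using Q(1) that by (auto simp: power_diff)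
    qed
    then show ?thesis by (auto simp: B_def Q)
  qed
  ultimately show ?thesis
    using Q(1) fa unfolding den fM by (simp add: divide_simps)
qed

text \<open>
  A pair of parameters \<open>e\<close>, \<open>a Q ^ (m + 1) / e\<close> contributes a polynomial of degree \<open>m\<close> in the
  node \<open>X k\<close>, because its quotients telescope to two products of length \<open>m\<close>, and the factors
  \<open>1 - a Q ^ (k + j) / e\<close> and \<open>1 - e Q ^ (k - j)\<close> multiply to
  \<open>Q ^ k (X k - (a Q ^ j / e + e / Q ^ j))\<close>.
\<close>

lemma well_poised_pair_factor:
  fixes a Q e :: "'a::field"
  assumes nz: "Q \<noteq> 0" "e \<noteq> 0"
    and f: "\<And>j. j < k \<or> j < m \<Longrightarrow> a * Q / e * Q ^ j \<noteq> 1"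
    and g: "\<And>j. j < k \<or> j < m \<Longrightarrow> e / Q ^ m * Q ^ j \<noteq> 1"
  shows "q_shifted_factorial e Q k / q_shifted_factorial (a * Q / e) Q k *
      (q_shifted_factorial (a * Q ^ Suc m / e) Q k / q_shifted_factorial (e / Q ^ m) Q k)
    = Q ^ (k * m) / (q_shifted_factorial (a * Q / e) Q m * q_shifted_factorial (e / Q ^ m) Q m) *
      (\<Prod>j=1..m. (1 / Q ^ k + a * Q ^ k) - (a * Q ^ j / e + e / Q ^ j))"
proof -
  let ?f = "q_shifted_factorial"
  have nonzero: "?f (a * Q / e) Q k \<noteq> 0" "?f (a * Q / e) Q m \<noteq> 0"
      "?f (e / Q ^ m) Q k \<noteq> 0" "?f (e / Q ^ m) Q m \<noteq> 0"
    using f g by (auto intro!: q_shifted_factorial_nonzero)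
  have 1: "?f (a * Q / e) Q m * ?f (a * Q ^ Suc m / e) Q k
      = ?f (a * Q / e) Q k * ?f (a * Q / e * Q ^ k) Q m"
    using q_shifted_factorial_add[of "a * Q / e" Q m k] q_shifted_factorial_add[of "a * Q / e" Q k m]
    by (simp add: add.commute mult.assoc)
  have 2: "?f (e / Q ^ m) Q m * ?f e Q k = ?f (e / Q ^ m) Q k * ?f (e / Q ^ m * Q ^ k) Q m"
    using q_shifted_factorial_add[of "e / Q ^ m" Q m k] q_shifted_factorial_add[of "e / Q ^ m" Q k m] nz
    by (simp add: add.commute)
  have "?f (a * Q / e * Q ^ k) Q m = (\<Prod>j=1..m. 1 - a * Q ^ k * Q ^ j / e)"
    unfolding q_shifted_factorial_def
    by (intro prod.reindex_bij_witness[of _ "\<lambda>j. j - 1" "\<lambda>j. Suc j"])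
       (auto simp: mult_ac simp flip: power_Suc)
  moreover have "?f (e / Q ^ m * Q ^ k) Q m = (\<Prod>j=1..m. 1 - e * Q ^ k / Q ^ j)"
    unfolding q_shifted_factorial_def using nz
    by (intro prod.reindex_bij_witness[of _ "\<lambda>j. m - j" "\<lambda>j. m - j"])
       (auto simp: power_diff field_simps)
  ultimately have "?f (a * Q / e * Q ^ k) Q m * ?f (e / Q ^ m * Q ^ k) Q m
      = (\<Prod>j=1..m. (1 - a * Q ^ k * Q ^ j / e) * (1 - e * Q ^ k / Q ^ j))"
    by (simp add: prod.distrib)
  also have "\<dots> = (\<Prod>j=1..m. Q ^ k * ((1 / Q ^ k + a * Q ^ k) - (a * Q ^ j / e + e / Q ^ j)))"
    using nz by (intro prod.cong refl) (simp add: field_simps)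
  also have "\<dots> = Q ^ (k * m) * (\<Prod>j=1..m. (1 / Q ^ k + a * Q ^ k) - (a * Q ^ j / e + e / Q ^ j))"
    by (simp add: prod.distrib power_mult)
  finally have 3: "?f (a * Q / e * Q ^ k) Q m * ?f (e / Q ^ m * Q ^ k) Q m = \<dots>" .
  have "?f e Q k / ?f (a * Q / e) Q k * (?f (a * Q ^ Suc m / e) Q k / ?f (e / Q ^ m) Q k)
    = (?f (a * Q / e * Q ^ k) Q m * ?f (e / Q ^ m * Q ^ k) Q m) /
      (?f (a * Q / e) Q m * ?f (e / Q ^ m) Q m)"
  proof -
    have "(?f (a * Q / e) Q m * ?f (a * Q ^ Suc m / e) Q k) * (?f (e / Q ^ m) Q m * ?f e Q k)
      = (?f (a * Q / e) Q k * ?f (a * Q / e * Q ^ k) Q m) *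
        (?f (e / Q ^ m) Q k * ?f (e / Q ^ m * Q ^ k) Q m)"
      unfolding 1 2 ..
    then show ?thesis using nonzero by (simp add: divide_simps mult_ac)
  qed
  then show ?thesis unfolding 3 by simp
qed

text \<open>
  A case of Gasper's very-well-poised summation of Karlsson-Minton type. By the two preceding
  lemmas the sum is a Lagrange-weighted sum of values of a polynomial of degree
  \<open>m * length es\<close>; the exponent \<open>t\<close> is what makes all powers of \<open>Q\<close> cancel, and \<open>t > 0\<close> says
  that this degree is less than \<open>M\<close>.
\<close>

lemma karlsson_minton_well_poised_sum_zero:
  fixes a Q :: "'a::field" and es :: "'a list"
  assumes Q: "Q \<noteq> 0" "\<And>j. 0 < j \<Longrightarrow> j \<le> M \<Longrightarrow> Q ^ j \<noteq> 1"
    and a: "\<And>j. j \<le> 2 * M \<Longrightarrow> a * Q ^ j \<noteq> 1"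
    and e: "\<And>e. e \<in> set es \<Longrightarrow> e \<noteq> 0"
      "\<And>e j. e \<in> set es \<Longrightarrow> j < M + m \<Longrightarrow> a * Q / e * Q ^ j \<noteq> 1"
      "\<And>e j. e \<in> set es \<Longrightarrow> j < M + m \<Longrightarrow> e / Q ^ m * Q ^ j \<noteq> 1"
    and M: "M = m * length es + t" and t: "0 < t"
  shows "(\<Sum>k\<le>M. (1 - a * Q ^ (2 * k)) *
      (q_shifted_factorial a Q k / q_shifted_factorial Q Q k) *
      (q_shifted_factorial (1 / Q ^ M) Q k / q_shifted_factorial (a * Q ^ Suc M) Q k) *
      (\<Prod>e\<leftarrow>es. q_shifted_factorial e Q k / q_shifted_factorial (a * Q / e) Q k *
        (q_shifted_factorial (a * Q ^ Suc m / e) Q k / q_shifted_factorial (e / Q ^ m) Q k)) *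
      Q ^ (t * k)) = 0"
    (is "(\<Sum>k\<le>M. ?w k * ?P k * _) = 0")
proof -
  define X where "X k = 1 / Q ^ k + a * Q ^ k" for k
  define pe where "pe e = (\<Prod>j=1..m. [:- (a * Q ^ j / e + e / Q ^ j), 1:])" for e
  define p where "p = (\<Prod>e\<leftarrow>es. pe e)"
  define C where "C e = 1 / (q_shifted_factorial (a * Q / e) Q m * q_shifted_factorial (e / Q ^ m) Q m)" for e
  define K where "K = q_shifted_factorial (1 / Q ^ M) Q M * q_shifted_factorial a Q (Suc M)"
  have deg_pe: "degree (pe e) = m" for e
    unfolding pe_def by (subst degree_prod_eq_sum_degree) auto
  have "degree p \<le> m * length es"
    unfolding p_def
  proof (induction es)
    case (Cons e es)
    have "degree (pe e * (\<Prod>e\<leftarrow>es. pe e)) \<le> degree (pe e) + degree (\<Prod>e\<leftarrow>es. pe e)"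
      by (rule degree_mult_le)
    with Cons deg_pe show ?case by (simp add: add.commute)
  qed simp
  then have deg: "degree p < M" using M t by simp
  have X_eq: "X k - X j = (1 - Q ^ k / Q ^ j) * (1 - a * Q ^ (k + j)) / Q ^ k" for k j
    using well_poised_node_diff[OF Q(1)] by (simp add: X_def power_add mult.assoc)
  have inj: "inj_on X {..M}"
  proof (rule linorder_inj_onI')
    fix i j assume ij: "i \<in> {..M}" "j \<in> {..M}" "i < j"
    then have "Q ^ (j - i) \<noteq> 1" "a * Q ^ (j + i) \<noteq> 1" using Q(2) a by auto
    then have "X j - X i \<noteq> 0" using Q(1) ij unfolding X_eq by (auto simp: power_diff)
    then show "X i \<noteq> X j" by auto
  qed
  have "?w k * ?P k * Q ^ (t * k)
      = K * prod_list (map C es) * (poly p (X k) / (\<Prod>j\<in>{..M} - {k}. X k - X j))"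
    if k: "k \<le> M" for k
  proof -
    have P: "?P k = Q ^ (k * (m * length es)) * (prod_list (map C es) * poly p (X k))"
      unfolding p_def using e
    proof (induction es)
      case (Cons e es)
      have "q_shifted_factorial e Q k / q_shifted_factorial (a * Q / e) Q k *
          (q_shifted_factorial (a * Q ^ Suc m / e) Q k / q_shifted_factorial (e / Q ^ m) Q k)
        = Q ^ (k * m) * (C e * poly (pe e) (X k))"
      proof -
        have bound: "j < M + m" if "j < k \<or> j < m" for j using that k by auto
        have "poly (pe e) (X k) = (\<Prod>j=1..m. X k - (a * Q ^ j / e + e / Q ^ j))"
          unfolding pe_def poly_prod by (intro prod.cong) auto
        then show ?thesis
          unfolding C_def X_def using Q(1) Cons.prems bound
          by (subst well_poised_pair_factor) auto
      qed
      with Cons show ?case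
        by (simp add: algebra_simps power_add)
    qed simp
    have "?w k * Q ^ (k * M) = K / (\<Prod>j\<in>{..M} - {k}. X k - X j)"
      unfolding K_def X_def using well_poised_lagrange_weight[OF Q a k] by simp
    moreover have "?w k * ?P k * Q ^ (t * k)
        = ?w k * Q ^ (k * M) * (prod_list (map C es) * poly p (X k))"
      unfolding P by (simp add: M power_add distrib_left mult_ac)
    ultimately show ?thesis by simp
  qed
  then have "(\<Sum>k\<le>M. ?w k * ?P k * Q ^ (t * k)) = K * prod_list (map C es) *
      (\<Sum>k\<le>M. poly p (X k) / (\<Prod>j\<in>{..M} - {k}. X k - X j))"
    by (simp add: sum_distrib_left)
  then show ?thesis
    using lagrange_weights_annihilate[OF inj deg] by simp
qed

section \<open>Logarithmic expansions modulo the fourth power of the variable\<close>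

definition eqmod :: "'a::comm_ring_1 \<Rightarrow> 'a \<Rightarrow> 'a \<Rightarrow> bool" where
  "eqmod m x y \<longleftrightarrow> m dvd x - y"

lemma eqmod_refl [simp]: "eqmod m x x"
  by (simp add: eqmod_def)

lemma eqmod_sym: "eqmod m x y \<Longrightarrow> eqmod m y x"
  unfolding eqmod_def by (subst dvd_minus_iff [symmetric]) simp

lemma eqmod_trans [trans]: "eqmod m x y \<Longrightarrow> eqmod m y z \<Longrightarrow> eqmod m x z"
  unfolding eqmod_def using dvd_add[of m "x - y" "y - z"] by simp

lemma eqmod_mult: "eqmod m x y \<Longrightarrow> eqmod m x' y' \<Longrightarrow> eqmod m (x * x') (y * y')"
proof -
  assume "eqmod m x y" "eqmod m x' y'"
  then have "m dvd (x - y) * x' + y * (x' - y')" unfolding eqmod_def by (intro dvd_add) simp_all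
  then show ?thesis unfolding eqmod_def by (simp add: algebra_simps)
qed

lemma eqmod_sum: "(\<And>i. i \<in> A \<Longrightarrow> eqmod m (f i) (g i)) \<Longrightarrow> eqmod m (sum f A) (sum g A)"
  unfolding eqmod_def by (simp add: dvd_sum flip: sum_subtractf)

lemma fps_X_power_dvd_iff: "fps_X ^ n dvd (f :: 'a::field fps) \<longleftrightarrow> (\<forall>i<n. f $ i = 0)"
proof (cases "f = 0")
  case False
  then have "fps_X ^ n dvd f \<longleftrightarrow> n \<le> subdegree f"
    by (simp add: fps_dvd_iff)
  also have "\<dots> \<longleftrightarrow> (\<forall>i<n. f $ i = 0)"
  proof
    show "\<forall>i<n. f $ i = 0" if "n \<le> subdegree f"
      using that by (auto intro: nth_less_subdegree_zero)
    show "n \<le> subdegree f" if "\<forall>i<n. f $ i = 0"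
      using that False by (auto intro: subdegree_geI)
  qed
  finally show ?thesis .
qed simp

abbreviation eqmod_X4 :: "complex fps \<Rightarrow> complex fps \<Rightarrow> bool"  (infix "\<approx>\<^sub>4" 50) where
  "f \<approx>\<^sub>4 g \<equiv> eqmod (fps_X ^ 4) f g"

text \<open>
  The truncation of \<open>exp (h x + h ^ 2 y + h ^ 3 z)\<close>, where \<open>h\<close> is the variable \<^const>\<open>fps_X\<close>.
\<close>

definition exp_jet :: "complex fps \<Rightarrow> complex fps \<Rightarrow> complex fps \<Rightarrow> complex fps" where
  "exp_jet x y z = 1 + fps_X * x + fps_X ^ 2 * (fps_const (1/2) * x ^ 2 + y)
     + fps_X ^ 3 * (fps_const (1/6) * x ^ 3 + x * y + z)"

lemma exp_jet_0: "exp_jet 0 y z = 1 + fps_X ^ 2 * y + fps_X ^ 3 * z"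
  by (simp add: exp_jet_def)

lemma cubic_truncation_mult:
  fixes h :: "'a::comm_ring_1"
  shows "(1 + h * x + h ^ 2 * b + h ^ 3 * c) * (1 + h * x' + h ^ 2 * b' + h ^ 3 * c') -
      (1 + h * (x + x') + h ^ 2 * (b + b' + x * x') + h ^ 3 * (c + c' + x * b' + x' * b))
    = h ^ 4 * ((x * c' + b * b' + c * x') + h * (b * c' + c * b') + h ^ 2 * (c * c'))"
  by (simp add: algebra_simps power2_eq_square power3_eq_cube power4_eq_xxxx)

lemma exp_jet_add: "exp_jet x y z * exp_jet x' y' z' \<approx>\<^sub>4 exp_jet (x + x') (y + y') (z + z')"
proof -
  define h :: "complex fps" where "h = fps_X"
  define i2 :: "complex fps" where "i2 = fps_const (1/2)"
  define i6 :: "complex fps" where "i6 = fps_const (1/6)"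
  have "fps_const (1/2) = (3 * fps_const (1/6) :: complex fps)"
    by (simp add: numeral_fps_const)
  then have i2: "i2 = 3 * i6" by (simp add: i2_def i6_def)
  define b c b' c' where "b = i2 * x ^ 2 + y" "c = i6 * x ^ 3 + x * y + z"
    "b' = i2 * x' ^ 2 + y'" "c' = i6 * x' ^ 3 + x' * y' + z'"
  have deg2: "i2 * (x + x') ^ 2 + (y + y') = b + b' + x * x'"
  proof -
    have "i2 * (x + x') ^ 2 = i2 * x ^ 2 + i2 * x' ^ 2 + (2 * i2) * (x * x')"
      by (simp add: algebra_simps power2_eq_square)
    moreover have "2 * i2 = 1" by (simp add: i2_def numeral_fps_const)
    ultimately show ?thesis by (simp add: b_c_b'_c'_def)
  qed
  have deg3: "i6 * (x + x') ^ 3 + (x + x') * (y + y') + (z + z') = c + c' + x * b' + x' * b"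
    unfolding b_c_b'_c'_def i2 by (simp add: algebra_simps power2_eq_square power3_eq_cube)
  have "exp_jet x y z * exp_jet x' y' z' - exp_jet (x + x') (y + y') (z + z')
      = h ^ 4 * ((x * c' + b * b' + c * x') + h * (b * c' + c * b') + h ^ 2 * (c * c'))"
    unfolding exp_jet_def h_def[symmetric] i2_def[symmetric] i6_def[symmetric] deg2 deg3
      b_c_b'_c'_def[symmetric]
    by (rule cubic_truncation_mult)
  then show ?thesis by (simp add: eqmod_def h_def)
qed

text \<open>
  A substitute for the expansion
  \<open>log (f s) = log f0 + l1 (s h) + l2 (s h) ^ 2 + l3 (s h) ^ 3 + \<dots>\<close> of a family of series
  in \<open>h\<close>, with coefficients \<open>f0, l1, l2, l3\<close> that may involve \<open>h\<close> but not \<open>s\<close>. Since logarithms turn products into sums, only power sums of the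
  arguments occur when members of one family are multiplied.
\<close>

definition log_jet ::
  "(int \<Rightarrow> complex fps) \<Rightarrow> complex fps \<Rightarrow> complex fps \<Rightarrow> complex fps \<Rightarrow> complex fps \<Rightarrow> bool" where
  "log_jet f f0 l1 l2 l3 \<longleftrightarrow>
     (\<forall>s. f s \<approx>\<^sub>4 f0 * exp_jet (l1 * of_int s) (l2 * of_int s ^ 2) (l3 * of_int s ^ 3))"

lemma log_jet_1: "log_jet (\<lambda>_. 1) 1 0 0 0"
  by (simp add: log_jet_def exp_jet_0)

lemma log_jet_mult:
  assumes "log_jet f f0 l1 l2 l3" "log_jet g g0 m1 m2 m3"
  shows "log_jet (\<lambda>s. f s * g s) (f0 * g0) (l1 + m1) (l2 + m2) (l3 + m3)"
  unfolding log_jet_def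
proof
  fix s
  let ?F = "exp_jet (l1 * of_int s) (l2 * of_int s ^ 2) (l3 * of_int s ^ 3)"
  let ?G = "exp_jet (m1 * of_int s) (m2 * of_int s ^ 2) (m3 * of_int s ^ 3)"
  have "f s * g s \<approx>\<^sub>4 (f0 * ?F) * (g0 * ?G)"
    using assms unfolding log_jet_def by (blast intro: eqmod_mult)
  also have "(f0 * ?F) * (g0 * ?G) = f0 * g0 * (?F * ?G)" by (simp add: mult_ac)
  also have "\<dots> \<approx>\<^sub>4 f0 * g0 * exp_jet (l1 * of_int s + m1 * of_int s)
      (l2 * of_int s ^ 2 + m2 * of_int s ^ 2) (l3 * of_int s ^ 3 + m3 * of_int s ^ 3)"
    by (intro eqmod_mult eqmod_refl exp_jet_add)
  finally show "f s * g s \<approx>\<^sub>4 f0 * g0 * exp_jet ((l1 + m1) * of_int s)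
      ((l2 + m2) * of_int s ^ 2) ((l3 + m3) * of_int s ^ 3)"
    by (simp add: distrib_right)
qed

lemma log_jet_prod:
  assumes "\<And>i. i \<in> A \<Longrightarrow> log_jet (f i) (f0 i) (l1 i) (l2 i) (l3 i)"
  shows "log_jet (\<lambda>s. \<Prod>i\<in>A. f i s) (\<Prod>i\<in>A. f0 i) (\<Sum>i\<in>A. l1 i) (\<Sum>i\<in>A. l2 i) (\<Sum>i\<in>A. l3 i)"
  using assms
  by (induction A rule: infinite_finite_induct) (auto intro: log_jet_1 log_jet_mult)

lemma log_jet_inverse:
  assumes f: "log_jet f f0 l1 l2 l3" and unit: "f0 $ 0 \<noteq> 0"
  shows "log_jet (\<lambda>s. inverse (f s)) (inverse f0) (- l1) (- l2) (- l3)"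
  unfolding log_jet_def
proof
  fix s
  define F where "F = exp_jet (l1 * of_int s) (l2 * of_int s ^ 2) (l3 * of_int s ^ 3)"
  define G where "G = exp_jet (- l1 * of_int s) (- l2 * of_int s ^ 2) (- l3 * of_int s ^ 3)"
  have fs: "f s \<approx>\<^sub>4 f0 * F" using f by (simp add: log_jet_def F_def)
  have FG: "F * G \<approx>\<^sub>4 1"
    using exp_jet_add[of "l1 * of_int s" "l2 * of_int s ^ 2" "l3 * of_int s ^ 3"
        "- l1 * of_int s" "- l2 * of_int s ^ 2" "- l3 * of_int s ^ 3"]
    by (simp add: F_def G_def exp_jet_0)
  have "(f s - f0 * F) $ 0 = 0"
    using fs by (simp add: eqmod_def fps_X_power_dvd_iff)
  then have unit': "f s $ 0 \<noteq> 0"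
    using unit by (simp add: F_def exp_jet_def)
  have "f s * (inverse f0 * G) \<approx>\<^sub>4 f0 * F * (inverse f0 * G)"
    by (intro eqmod_mult fs eqmod_refl)
  also have "\<dots> = F * G * (f0 * inverse f0)" by (simp add: mult_ac)
  also have "f0 * inverse f0 = 1" using unit by (simp add: inverse_mult_eq_1')
  also have "F * G * 1 \<approx>\<^sub>4 1" using FG by simp
  finally have "inverse (f s) * (f s * (inverse f0 * G)) \<approx>\<^sub>4 inverse (f s) * 1"
    by (intro eqmod_mult eqmod_refl)
  moreover have "inverse (f s) * (f s * (inverse f0 * G)) = inverse f0 * G"
    using inverse_mult_eq_1[OF unit'] by (simp flip: mult.assoc)
  ultimately show "inverse (f s) \<approx>\<^sub>4 inverse f0 * exp_jet (- l1 * of_int s) (- l2 * of_int s ^ 2) (- l3 * of_int s ^ 3)"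
    unfolding G_def by (simp add: eqmod_sym del: mult_minus_left)
qed

lemma log_jet_uminus:
  assumes "log_jet f f0 l1 l2 l3"
  shows "log_jet (\<lambda>s. f (- s)) f0 (- l1) l2 (- l3)"
  unfolding log_jet_def
proof
  fix s
  show "f (- s) \<approx>\<^sub>4 f0 * exp_jet (- l1 * of_int s) (l2 * of_int s ^ 2) (- l3 * of_int s ^ 3)"
    using assms[unfolded log_jet_def, rule_format, of "- s"] by simp
qed

text \<open>
  If the arguments have sum 0, the first-order term disappears, and the product depends on
  the arguments only through their power sums of orders 2 and 3.
\<close>

lemma log_jet_prod_list:
  assumes "log_jet f f0 l1 l2 l3"
  shows "(\<Prod>s\<leftarrow>ss. f s) \<approx>\<^sub>4 f0 ^ length ss * exp_jet (l1 * of_int (\<Sum>s\<leftarrow>ss. s))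
     (l2 * of_int (\<Sum>s\<leftarrow>ss. s ^ 2)) (l3 * of_int (\<Sum>s\<leftarrow>ss. s ^ 3))"
proof (induction ss)
  case (Cons s ss)
  let ?F = "exp_jet (l1 * of_int s) (l2 * of_int s ^ 2) (l3 * of_int s ^ 3)"
  let ?G = "exp_jet (l1 * of_int (\<Sum>s\<leftarrow>ss. s)) (l2 * of_int (\<Sum>s\<leftarrow>ss. s ^ 2))
    (l3 * of_int (\<Sum>s\<leftarrow>ss. s ^ 3))"
  have "(\<Prod>s\<leftarrow>s # ss. f s) = f s * (\<Prod>s\<leftarrow>ss. f s)" by simp
  also have "\<dots> \<approx>\<^sub>4 (f0 * ?F) * (f0 ^ length ss * ?G)"
    using assms Cons unfolding log_jet_def by (blast intro: eqmod_mult)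
  also have "\<dots> = f0 ^ length (s # ss) * (?F * ?G)" by (simp add: mult_ac)
  also have "\<dots> \<approx>\<^sub>4 f0 ^ length (s # ss) * exp_jet
      (l1 * of_int s + l1 * of_int (\<Sum>s\<leftarrow>ss. s))
      (l2 * of_int s ^ 2 + l2 * of_int (\<Sum>s\<leftarrow>ss. s ^ 2))
      (l3 * of_int s ^ 3 + l3 * of_int (\<Sum>s\<leftarrow>ss. s ^ 3))"
    by (intro eqmod_mult eqmod_refl exp_jet_add)
  finally show ?case by (simp add: distrib_left)
qed (simp add: exp_jet_0)

lemma fps_exp_jet:
  "fps_exp (of_int s) \<approx>\<^sub>4 1 + fps_X * of_int s + fps_X ^ 2 * (fps_const (1/2) * of_int s ^ 2)
     + fps_X ^ 3 * (fps_const (1/6) * of_int s ^ 3)"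
proof -
  define c :: complex where "c = of_int s"
  have c: "(of_int s :: complex fps) = fps_const c"
    unfolding c_def by (rule fps_of_int[symmetric])
  have "(fps_exp c - (1 + fps_X * fps_const c + fps_X ^ 2 * (fps_const (1/2) * fps_const c ^ 2)
     + fps_X ^ 3 * (fps_const (1/6) * fps_const c ^ 3))) $ i = 0" if "i < 4" for i
  proof -
    from that have "i = 0 \<or> i = 1 \<or> i = 2 \<or> i = 3" by auto
    then show ?thesis
      by (auto simp: fps_X_power_mult_nth fact_numeral)
  qed
  then show ?thesis
    unfolding eqmod_def fps_X_power_dvd_iff c c_def[symmetric] by blast
qed

text \<open>
  With \<open>\<rho> = \<beta> / (1 - \<beta>)\<close> the function is \<open>(1 - \<beta>) (1 - \<rho> (exp (s h) - 1))\<close>; the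
  coefficients are those of the logarithm of the second factor.
\<close>

lemma log_jet_one_minus_exp:
  assumes "\<beta> $ 0 \<noteq> (1::complex)"
  defines "\<rho> \<equiv> \<beta> * inverse (1 - \<beta>)"
  shows "log_jet (\<lambda>s. 1 - \<beta> * fps_exp (of_int s)) (1 - \<beta>) (- \<rho>)
     (- fps_const (1/2) * (\<rho> + \<rho> ^ 2)) (- fps_const (1/6) * ((1 + 2 * \<rho>) * (\<rho> + \<rho> ^ 2)))"
  unfolding log_jet_def
proof
  fix s
  define i2 :: "complex fps" where "i2 = fps_const (1/2)"
  define i6 :: "complex fps" where "i6 = fps_const (1/6)"
  have "fps_const (1/2) = (3 * fps_const (1/6) :: complex fps)"
    by (simp add: numeral_fps_const)
  then have i2: "i2 = 3 * i6" by (simp add: i2_def i6_def)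
  define c :: "complex fps" where "c = of_int s"
  have rho: "(1 - \<beta>) * \<rho> = \<beta>"
    using assms by (simp add: \<rho>_def mult.left_commute inverse_mult_eq_1')
  \<comment> \<open>The quadratic and cubic coefficients of \<^const>\<open>exp_jet\<close> reduce to those of
    \<open>1 - \<rho> (exp (c h) - 1)\<close>.\<close>
  have A2: "i2 * (- \<rho> * c) ^ 2 + - i2 * (\<rho> + \<rho> ^ 2) * c ^ 2 = - \<rho> * (i2 * c ^ 2)"
    by (simp add: algebra_simps power2_eq_square)
  have A3: "i6 * (- \<rho> * c) ^ 3 + - \<rho> * c * (- i2 * (\<rho> + \<rho> ^ 2) * c ^ 2)
      + - i6 * ((1 + 2 * \<rho>) * (\<rho> + \<rho> ^ 2)) * c ^ 3 = - \<rho> * (i6 * c ^ 3)"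
    unfolding i2 by (simp add: algebra_simps power2_eq_square power3_eq_cube)
  have jet: "(1 - \<beta>) * exp_jet (- \<rho> * c) (- i2 * (\<rho> + \<rho> ^ 2) * c ^ 2)
        (- i6 * ((1 + 2 * \<rho>) * (\<rho> + \<rho> ^ 2)) * c ^ 3)
      = 1 - \<beta> * (1 + fps_X * c + fps_X ^ 2 * (i2 * c ^ 2) + fps_X ^ 3 * (i6 * c ^ 3))"
  proof -
    define E where "E = fps_X * c + fps_X ^ 2 * (i2 * c ^ 2) + fps_X ^ 3 * (i6 * c ^ 3)"
    have "(1 - \<beta>) * exp_jet (- \<rho> * c) (- i2 * (\<rho> + \<rho> ^ 2) * c ^ 2)
        (- i6 * ((1 + 2 * \<rho>) * (\<rho> + \<rho> ^ 2)) * c ^ 3) = (1 - \<beta>) - (1 - \<beta>) * \<rho> * E"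
      unfolding exp_jet_def i2_def[symmetric] i6_def[symmetric] A2 A3 E_def
      by (simp add: algebra_simps)
    then show ?thesis
      unfolding rho by (simp add: E_def algebra_simps)
  qed
  have "\<beta> * fps_exp (of_int s) \<approx>\<^sub>4
      \<beta> * (1 + fps_X * c + fps_X ^ 2 * (i2 * c ^ 2) + fps_X ^ 3 * (i6 * c ^ 3))"
    unfolding c_def i2_def i6_def by (intro eqmod_mult eqmod_refl fps_exp_jet)
  then have "1 - \<beta> * fps_exp (of_int s) \<approx>\<^sub>4
      1 - \<beta> * (1 + fps_X * c + fps_X ^ 2 * (i2 * c ^ 2) + fps_X ^ 3 * (i6 * c ^ 3))"
    unfolding eqmod_def by (subst dvd_minus_iff[symmetric]) simp
  also note jet [symmetric]
  finally show "1 - \<beta> * fps_exp (of_int s) \<approx>\<^sub>4 (1 - \<beta>) * exp_jet (- \<rho> * of_int s)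
      (- fps_const (1/2) * (\<rho> + \<rho> ^ 2) * of_int s ^ 2)
      (- fps_const (1/6) * ((1 + 2 * \<rho>) * (\<rho> + \<rho> ^ 2)) * of_int s ^ 3)"
    unfolding i2_def i6_def c_def .
qed

section \<open>Evaluation of rational functions at a transcendental point\<close>

text \<open>
  The value at \<open>z\<close> of a rational function. It is a ring homomorphism only if no denominator
  vanishes at \<open>z\<close>, that is, for transcendental \<open>z\<close>.
\<close>

definition eval_fract :: "'a::field_char_0 \<Rightarrow> rat poly fract \<Rightarrow> 'a" where
  "eval_fract z x = poly (map_poly of_rat (fst (quot_of_fract x))) z /
     poly (map_poly of_rat (snd (quot_of_fract x))) z"

locale transcendental_point =
  fixes z :: "'a::field_char_0"
  assumes poly_nonzero: "p \<noteq> 0 \<Longrightarrow> poly (map_poly of_rat p) z \<noteq> 0"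
begin

abbreviation ev :: "rat poly \<Rightarrow> 'a" where "ev p \<equiv> poly (map_poly of_rat p) z"

lemma eval_fract_quotient:
  assumes "b \<noteq> 0"
  shows "eval_fract z (to_fract a / to_fract b) = ev a / ev b"
proof -
  define x where "x = to_fract a / to_fract b"
  define a' b' where "a' = fst (quot_of_fract x)" and "b' = snd (quot_of_fract x)"
  have b': "b' \<noteq> 0" by (simp add: b'_def)
  have "to_fract a' / to_fract b' = x"
    using Fract_quot_of_fract[of x] by (simp only: a'_def b'_def Fract_conv_to_fract)
  then have "to_fract (a' * b) = to_fract (a * b')"
    using assms b' by (simp add: x_def frac_eq_eq)
  then have "a' * b = a * b'" by (simp only: to_fract_eq_iff)
  then have "ev a' * ev b = ev a * ev b'"
    by (simp flip: poly_mult map_poly_of_rat_mult)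
  then show ?thesis
    using poly_nonzero[OF assms] poly_nonzero[OF b']
    by (simp add: eval_fract_def frac_eq_eq flip: x_def a'_def b'_def)
qed

lemma fract_quotientE:
  fixes x :: "rat poly fract"
  obtains a b where "b \<noteq> 0" "x = to_fract a / to_fract b"
proof
  show "snd (quot_of_fract x) \<noteq> 0" by simp
  show "x = to_fract (fst (quot_of_fract x)) / to_fract (snd (quot_of_fract x))"
    by (simp flip: Fract_conv_to_fract)
qed

lemma eval_fract_mult [simp]: "eval_fract z (x * y) = eval_fract z x * eval_fract z y"
proof -
  obtain a b c d where *: "b \<noteq> 0" "x = to_fract a / to_fract b" "d \<noteq> 0" "y = to_fract c / to_fract d"
    by (meson fract_quotientE)
  then have "x * y = to_fract (a * c) / to_fract (b * d)" by simp
  then show ?thesis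
    using * by (simp add: eval_fract_quotient map_poly_of_rat_mult del: to_fract_mult)
qed

lemma eval_fract_add [simp]: "eval_fract z (x + y) = eval_fract z x + eval_fract z y"
proof -
  obtain a b c d where *: "b \<noteq> 0" "x = to_fract a / to_fract b" "d \<noteq> 0" "y = to_fract c / to_fract d"
    by (meson fract_quotientE)
  then have "x + y = to_fract (a * d + c * b) / to_fract (b * d)" by (simp add: add_frac_eq)
  then show ?thesis
    using * by (simp add: eval_fract_quotient map_poly_of_rat_mult map_poly_of_rat_add
        add_frac_eq poly_nonzero del: to_fract_mult to_fract_add)
qed

lemma eval_fract_0 [simp]: "eval_fract z 0 = 0"
  by (simp add: eval_fract_def)

lemma eval_fract_1 [simp]: "eval_fract z 1 = 1"
  by (simp add: eval_fract_def)

lemma eval_fract_q_var [simp]: "eval_fract z q_var = z"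
  by (simp add: eval_fract_def q_var_def map_poly_pCons)

lemma eval_fract_minus [simp]: "eval_fract z (x - y) = eval_fract z x - eval_fract z y"
  using eval_fract_add[of "x - y" y] by (simp add: algebra_simps)

lemma eval_fract_inverse [simp]: "eval_fract z (inverse x) = inverse (eval_fract z x)"
proof (cases "x = 0")
  case False
  then have "eval_fract z x * eval_fract z (inverse x) = 1"
    by (simp flip: eval_fract_mult)
  then show ?thesis by (metis inverse_unique)
qed simp

lemma eval_fract_divide [simp]: "eval_fract z (x / y) = eval_fract z x / eval_fract z y"
  by (simp add: divide_inverse)

lemma eval_fract_power [simp]: "eval_fract z (x ^ n) = eval_fract z x ^ n"
  by (induction n) simp_all

lemma eval_fract_power_int [simp]: "eval_fract z (x powi i) = eval_fract z x powi i"
  by (simp add: power_int_def)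

lemma eval_fract_sum [simp]: "eval_fract z (sum f A) = (\<Sum>i\<in>A. eval_fract z (f i))"
  by (induction A rule: infinite_finite_induct) simp_all

lemma eval_fract_prod [simp]: "eval_fract z (prod f A) = (\<Prod>i\<in>A. eval_fract z (f i))"
  by (induction A rule: infinite_finite_induct) simp_all

end

section \<open>Expansion near a complex number\<close>

lemma of_rat_fls: "(of_rat x :: 'a::field_char_0 fls) = fls_const (of_rat x)"
proof (cases x)
  case (Fract a b)
  then show ?thesis
    by (simp add: of_rat_rat fls_of_int fls_const_divide_const)
qed

text \<open>
  Evaluation of polynomials with coefficients in the field of constants, for which the order
  of a root can be compared with the order of the resulting series.
\<close>

definition eval_fls :: "'a::field fls \<Rightarrow> 'a poly \<Rightarrow> 'a fls" where
  "eval_fls z p = poly (map_poly fls_const p) z"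

lemma eval_fls_pCons: "eval_fls z (pCons a p) = fls_const a + z * eval_fls z p"
  by (simp add: eval_fls_def map_poly_pCons)

lemma eval_fls_0 [simp]: "eval_fls z 0 = 0"
  by (simp add: eval_fls_def)

lemma eval_fls_add: "eval_fls z (p + q) = eval_fls z p + eval_fls z q"
proof -
  have "map_poly fls_const (p + q) = map_poly fls_const p + map_poly fls_const q"
    by (intro poly_eqI) (simp add: coeff_map_poly fls_plus_const)
  then show ?thesis by (simp add: eval_fls_def)
qed

lemma eval_fls_smult: "eval_fls z (smult c p) = fls_const c * eval_fls z p"
proof -
  have "map_poly fls_const (smult c p) = smult (fls_const c) (map_poly fls_const p)"
    by (intro poly_eqI) (simp add: coeff_map_poly)
  then show ?thesis by (simp add: eval_fls_def)
qed

lemma eval_fls_mult: "eval_fls z (p * q) = eval_fls z p * eval_fls z q"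
proof (induction p)
  case (pCons a p)
  then show ?case
    by (simp add: eval_fls_pCons eval_fls_add eval_fls_smult algebra_simps)
qed simp

lemma eval_fls_power: "eval_fls z (p ^ n) = eval_fls z p ^ n"
  by (induction n) (simp_all add: eval_fls_mult, simp add: eval_fls_def)

lemma eval_fls_of_rat:
  "poly (map_poly of_rat p) (z :: 'a::field_char_0 fls) = eval_fls z (map_poly of_rat p)"
proof -
  have "map_poly of_rat p = map_poly fls_const (map_poly (of_rat :: rat \<Rightarrow> 'a) p)"
    by (intro poly_eqI) (simp add: coeff_map_poly of_rat_fls)
  then show ?thesis by (simp add: eval_fls_def)
qed

text \<open>
  The indeterminate \<open>q\<close> in a neighbourhood of \<open>\<zeta>\<close>, in the exponential coordinate:
  \<open>q = \<zeta> exp h\<close>. Then every power of \<open>q ^ n\<close>, with \<open>\<zeta> ^ n = 1\<close>, is an exponential \<open>exp (n c h)\<close>.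
\<close>

definition q_near :: "complex \<Rightarrow> complex fps" where
  "q_near \<zeta> = fps_const \<zeta> * fps_exp 1"

lemma eval_fls_q_near_integral:
  "\<exists>g. eval_fls (fps_to_fls (q_near \<zeta>)) p = fps_to_fls g \<and> g $ 0 = poly p \<zeta>"
proof (induction p)
  case 0
  show ?case by (intro exI[of _ 0]) simp
next
  case (pCons a p)
  then obtain g where "eval_fls (fps_to_fls (q_near \<zeta>)) p = fps_to_fls g" "g $ 0 = poly p \<zeta>"
    by blast
  then show ?case
    by (intro exI[of _ "fps_const a + q_near \<zeta> * g"])
      (simp add: eval_fls_pCons fls_times_fps_to_fls q_near_def)
qed

text \<open>
  The difference \<open>\<zeta> exp h - \<zeta>\<close> has a simple zero at \<open>h = 0\<close>, so the order of vanishing in \<open>h\<close>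
  is the multiplicity of the root \<open>\<zeta>\<close>.
\<close>

lemma eval_fls_q_near_order:
  assumes "\<zeta> \<noteq> 0" "p \<noteq> 0"
  obtains g where "eval_fls (fps_to_fls (q_near \<zeta>)) p = fps_to_fls (fps_X ^ order \<zeta> p * g)" "g $ 0 \<noteq> 0"
proof -
  \<comment> \<open>The factor \<open>u\<close> is a unit since its constant coefficient is the derivative \<open>\<zeta>\<close> of \<open>\<zeta> exp h\<close> at 0.\<close>
  have "fps_X ^ 1 dvd q_near \<zeta> - fps_const \<zeta>"
    unfolding fps_X_power_dvd_iff by (simp add: q_near_def)
  then obtain u where u: "q_near \<zeta> - fps_const \<zeta> = fps_X * u" by (auto elim: dvdE)
  have "u $ 0 = (fps_X * u) $ 1" by simp
  also have "\<dots> = \<zeta>" by (simp flip: u add: q_near_def)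
  finally have u0: "u $ 0 \<noteq> 0" using assms by simp
  have lin: "eval_fls (fps_to_fls (q_near \<zeta>)) [:-\<zeta>, 1:] = fps_to_fls (fps_X * u)"
    by (simp add: eval_fls_pCons flip: u)
  obtain q where q: "p = [:-\<zeta>, 1:] ^ order \<zeta> p * q" "\<not> [:-\<zeta>, 1:] dvd q"
    using order_decomp[OF assms(2)] by blast
  obtain v where v: "eval_fls (fps_to_fls (q_near \<zeta>)) q = fps_to_fls v" "v $ 0 = poly q \<zeta>"
    using eval_fls_q_near_integral by blast
  show ?thesis
  proof
    show "eval_fls (fps_to_fls (q_near \<zeta>)) p = fps_to_fls (fps_X ^ order \<zeta> p * (u ^ order \<zeta> p * v))"
      by (subst q(1)) (simp add: eval_fls_mult eval_fls_power lin v
        fls_times_fps_to_fls fps_to_fls_power power_mult_distrib mult_ac)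
    show "(u ^ order \<zeta> p * v) $ 0 \<noteq> 0"
      using u0 q(2) by (simp add: v fps_power_zeroth poly_eq_0_iff_dvd)
  qed
qed

lemma transcendental_q_near:
  assumes "\<zeta> \<noteq> 0"
  shows "transcendental_point (fps_to_fls (q_near \<zeta>))"
proof
  fix p :: "rat poly" assume "p \<noteq> 0"
  then have "map_poly of_rat p \<noteq> (0 :: complex poly)"
    using inj_map_poly_of_rat[of p 0] by auto
  then obtain g where g: "eval_fls (fps_to_fls (q_near \<zeta>)) (map_poly of_rat p) =
      fps_to_fls (fps_X ^ order \<zeta> (map_poly of_rat p) * g)" "g $ 0 \<noteq> 0"
    using eval_fls_q_near_order[OF assms] by blast
  then show "poly (map_poly of_rat p) (fps_to_fls (q_near \<zeta>)) \<noteq> 0"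
    unfolding eval_fls_of_rat by auto
qed

section \<open>Divisibility by powers of cyclotomic polynomials\<close>

text \<open>
  Division with remainder over the rationals remains division with remainder over the complex
  numbers.
\<close>

lemma map_poly_of_rat_dvd_iff:
  "map_poly of_rat p dvd (map_poly of_rat q :: complex poly) \<longleftrightarrow> p dvd q"
proof
  assume dvd: "map_poly of_rat p dvd (map_poly of_rat q :: complex poly)"
  show "p dvd q"
  proof (cases "p = 0")
    case True
    with dvd have "map_poly of_rat q = (map_poly of_rat 0 :: complex poly)" by simp
    then have "q = 0" by (rule inj_map_poly_of_rat)
    then show ?thesis by simp
  next
    case False
    have "(map_poly of_rat q :: complex poly) = map_poly of_rat (q div p * p + q mod p)" by simp
    also have "\<dots> = map_poly of_rat (q div p) * map_poly of_rat p + map_poly of_rat (q mod p)"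
      by (simp only: map_poly_of_rat_add map_poly_of_rat_mult)
    finally have "map_poly of_rat p dvd (map_poly of_rat (q mod p) :: complex poly)"
      using dvd by (metis dvd_add_right_iff dvd_triv_right)
    then have "map_poly of_rat (q mod p) = (0 :: complex poly) \<or> degree p \<le> degree (q mod p)"
      by (metis dvd_imp_degree_le degree_map_poly_of_rat)
    then have "q mod p = 0"
      using degree_mod_less[OF False, of q] inj_map_poly_of_rat[of "q mod p" 0] by auto
    then show ?thesis by auto
  qed
next
  assume "p dvd q"
  then show "map_poly of_rat p dvd (map_poly of_rat q :: complex poly)"
    by (auto elim!: dvdE simp: map_poly_of_rat_mult)
qed

definition primitive_root :: "nat \<Rightarrow> complex \<Rightarrow> bool" where
  "primitive_root n \<zeta> \<longleftrightarrow> (\<forall>i. \<zeta> powi i = 1 \<longleftrightarrow> int n dvd i)"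

lemma primitive_root_nonzero: "n > 0 \<Longrightarrow> primitive_root n \<zeta> \<Longrightarrow> \<zeta> \<noteq> 0"
  unfolding primitive_root_def by (metis dvd_refl power_int_0_left_if of_nat_eq_0_iff less_not_refl zero_neq_one)

lemma primitive_root_cis:
  assumes "n > 0"
  shows "primitive_root n (cis (2 * pi / n))"
  unfolding primitive_root_def
proof
  fix i :: int
  let ?w = "cis (2 * pi / n)"
  define j where "j = nat (i mod n)"
  have j: "int j = i mod n" "j < n" using assms by (simp_all add: j_def nat_less_iff)
  have wn: "?w powi (int n * (i div n)) = 1"
    using assms by (simp add: power_int_mult Complex.DeMoivre)
  have "i = int n * (i div n) + int j" by (simp add: j)
  then have "?w powi i = ?w powi (int n * (i div n) + int j)" by simp
  also have "\<dots> = ?w ^ j"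
    by (subst power_int_add) (simp_all add: wn)
  also have "\<dots> = cis (2 * pi * real j / real n)"
    by (simp add: Complex.DeMoivre mult_ac)
  also have "\<dots> = 1 \<longleftrightarrow> j = 0"
    using inj_onD[OF bij_betw_imp_inj_on[OF bij_betw_roots_unity[OF assms]], of j 0] j(2) assms
    by auto
  also have "\<dots> \<longleftrightarrow> int n dvd i"
    using j(1) by (auto simp: dvd_eq_mod_eq_0)
  finally show "?w powi i = 1 \<longleftrightarrow> int n dvd i" .
qed

lemma primitive_root_power:
  assumes "primitive_root n \<zeta>" "coprime n k"
  shows "primitive_root n (\<zeta> ^ k)"
  using assms unfolding primitive_root_def
  by (simp add: power_int_power coprime_dvd_mult_right_iff)

lemma coprime_linear_factors:
  assumes "a \<noteq> b"
  shows "coprime [:- a, 1:] [:- b, 1 :: 'a::field_gcd:]"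
proof (rule coprimeI)
  fix c assume "c dvd [:- a, 1:]" "c dvd [:- b, 1:]"
  then have "c dvd [:- a, 1:] - [:- b, 1:]" by (rule dvd_diff)
  moreover have "[:- a, 1:] - [:- b, 1:] = [:b - a:]" by simp
  moreover have "[:b - a:] dvd 1" using assms by (simp add: is_unit_pCons_iff)
  ultimately show "c dvd 1" by (metis dvd_trans)
qed

lemma cyclotomic_power_dvd:
  fixes p :: "rat poly"
  assumes n: "n > 0" and root: "\<And>\<zeta>. primitive_root n \<zeta> \<Longrightarrow> [:-\<zeta>, 1:] ^ e dvd map_poly of_rat p"
  shows "cyclotomic n ^ e dvd p"
proof -
  let ?w = "cis (2 * pi / n)" and ?K = "{k. 1 \<le> k \<and> k \<le> n \<and> coprime n k}"
  have w: "primitive_root n ?w" by (rule primitive_root_cis[OF n])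
  have w0: "?w \<noteq> 0" by simp
  have inj: "k = l" if "?w ^ k = ?w ^ l" "k \<in> ?K" "l \<in> ?K" for k l
  proof -
    have "?w powi (int k - int l) = 1"
      using that(1) w0 by (simp add: power_int_diff)
    then have "int n dvd int k - int l" using w by (simp add: primitive_root_def)
    moreover have "\<bar>int k - int l\<bar> < int n" using that by auto
    ultimately have "int k - int l = 0" using zdvd_not_zless[of "\<bar>int k - int l\<bar>" "int n"] by (auto simp: zero_less_abs_iff)
    then show ?thesis by simp
  qed
  have "(\<Prod>k\<in>K. [:- (?w ^ k), 1:] ^ e) dvd map_poly of_rat p" if "finite K" "K \<subseteq> ?K" for K
    using that
  proof (induction K rule: finite_induct)
    case (insert k K)
    have "coprime ([:- (?w ^ k), 1:] ^ e) (\<Prod>l\<in>K. [:- (?w ^ l), 1:] ^ e)"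
      using insert.hyps insert.prems inj
      by (intro prod_coprime_right) (auto intro!: coprime_linear_factors)
    moreover have "[:- (?w ^ k), 1:] ^ e dvd map_poly of_rat p"
      using root primitive_root_power[OF w] insert.prems by blast
    ultimately show ?case
      using insert by (auto intro: divides_mult)
  qed simp
  from this[of ?K] have "map_poly of_rat (cyclotomic n) ^ e dvd (map_poly of_rat p :: complex poly)"
    by (simp add: of_rat_cyclotomic cyclotomic_complex_def prod_power_distrib)
  moreover have "map_poly of_rat (q ^ e) = (map_poly of_rat q ^ e :: complex poly)" for q
    by (induction e) (simp_all add: map_poly_of_rat_mult)
  ultimately have "map_poly of_rat (cyclotomic n ^ e) dvd (map_poly of_rat p :: complex poly)"
    by simp
  then show ?thesis by (simp only: map_poly_of_rat_dvd_iff)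
qed

text \<open>
  The congruence may be tested at one primitive root of unity at a time, by the order of
  vanishing of the expansion there: the denominator in lowest terms is expanded as a power
  series, so it can only raise the order of the numerator.
\<close>

lemma fract_cong_0_cyclotomic_power:
  assumes n: "n > 0"
    and local: "\<And>\<zeta>. primitive_root n \<zeta> \<Longrightarrow>
      \<exists>f. eval_fract (fps_to_fls (q_near \<zeta>)) x = fps_to_fls (fps_X ^ e * f)"
  shows "fract_cong x 0 (cyclotomic n ^ e)"
proof -
  define a b where "a = fst (quot_of_fract x)" and "b = snd (quot_of_fract x)"
  have "cyclotomic n ^ e dvd a"
  proof (cases "a = 0")
    case False
    show ?thesis
    proof (rule cyclotomic_power_dvd[OF n])
      fix \<zeta> :: complex assume prim: "primitive_root n \<zeta>"
      have z0: "\<zeta> \<noteq> 0" using primitive_root_nonzero[OF n prim] .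
      let ?z = "fps_to_fls (q_near \<zeta>)" and ?a = "map_poly of_rat a :: complex poly"
      have nz: "?a \<noteq> 0" using False inj_map_poly_of_rat[of a 0] by auto
      obtain g where g: "eval_fls ?z ?a = fps_to_fls (fps_X ^ order \<zeta> ?a * g)" "g $ 0 \<noteq> 0"
        using eval_fls_q_near_order[OF z0 nz] .
      obtain h where h: "eval_fls ?z (map_poly of_rat b) = fps_to_fls h"
        using eval_fls_q_near_integral by blast
      have "poly (map_poly of_rat b) ?z \<noteq> 0"
        by (intro transcendental_point.poly_nonzero transcendental_q_near z0) (simp add: b_def)
      then have h0: "fps_to_fls h \<noteq> 0" by (simp only: eval_fls_of_rat h not_False_eq_True)
      obtain f where f: "eval_fract ?z x = fps_to_fls (fps_X ^ e * f)"
        using local[OF prim] by blast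
      have "eval_fract ?z x = fps_to_fls (fps_X ^ order \<zeta> ?a * g) / fps_to_fls h"
        unfolding eval_fract_def eval_fls_of_rat a_def[symmetric] b_def[symmetric] g h ..
      then have "fps_to_fls (fps_X ^ order \<zeta> ?a * g) = fps_to_fls (fps_X ^ e * f * h)"
        using f h0 by (simp add: fls_times_fps_to_fls nonzero_divide_eq_eq)
      then have eq: "fps_X ^ order \<zeta> ?a * g = fps_X ^ e * f * h"
        by (simp only: fps_to_fls_eq_iff)
      have "e \<le> order \<zeta> ?a"
      proof (rule ccontr)
        assume "\<not> e \<le> order \<zeta> ?a"
        then have "(fps_X ^ e * (f * h)) $ order \<zeta> ?a = 0"
          by (simp add: fps_X_power_mult_nth)
        moreover have "(fps_X ^ order \<zeta> ?a * g) $ order \<zeta> ?a = g $ 0"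
          by (simp add: fps_X_power_mult_nth)
        ultimately show False using eq g(2) by (simp add: mult.assoc)
      qed
      then show "[:-\<zeta>, 1:] ^ e dvd ?a" by (simp add: order_divides)
    qed
  qed simp
  then show ?thesis by (simp add: fract_cong_def a_def)
qed

section \<open>Reflection identities\<close>

text \<open>
  The coefficient of \<open>t ^ 3\<close> in \<open>log (1 - \<beta> exp t)\<close>.
\<close>

definition log_coeff3 :: "complex \<Rightarrow> complex" where
  "log_coeff3 \<beta> = - (1/6) * ((1 + 2 * (\<beta> / (1 - \<beta>))) * (\<beta> / (1 - \<beta>) + (\<beta> / (1 - \<beta>)) ^ 2))"

text \<open>
  The functions \<open>1 - \<beta> exp t\<close> and \<open>1 - \<beta>\<inverse> exp (- t)\<close> differ by the factor
  \<open>- \<beta> exp t\<close>, whose logarithm is linear in \<open>t\<close>, and \<open>t \<mapsto> - t\<close> changes the sign of the cubic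
  coefficient.
\<close>

lemma log_coeff3_inverse:
  assumes "\<beta> \<noteq> 0" "\<beta> \<noteq> 1"
  shows "log_coeff3 (inverse \<beta>) = - log_coeff3 \<beta>"
proof -
  have "inverse \<beta> / (1 - inverse \<beta>) = 1 / (\<beta> - 1)"
    using assms by (simp add: field_simps)
  also have "\<dots> = - (1 + \<beta> / (1 - \<beta>))"
    using assms by (simp add: divide_simps)
  finally have eq: "inverse \<beta> / (1 - inverse \<beta>) = - (1 + \<beta> / (1 - \<beta>))" .
  define \<rho> where "\<rho> = \<beta> / (1 - \<beta>)"
  show ?thesis
    unfolding log_coeff3_def eq \<rho>_def[symmetric] by (simp add: algebra_simps power2_eq_square)
qed

lemma sum_reflection_difference:
  fixes g :: "nat \<Rightarrow> 'a::ab_group_add"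
  assumes "k \<le> M"
  shows "(\<Sum>j<M - k. g (Suc j) - g (M - j)) = (\<Sum>j<k. g (Suc j) - g (M - j))"
proof -
  define H where "H k = (\<Sum>j<k. g (Suc j))" for k
  have H: "(\<Sum>j<k. g (M - j)) = H M - H (M - k)" if "k \<le> M" for k
    using that
  proof (induction k)
    case (Suc k)
    then have "M - k = Suc (M - Suc k)" by simp
    then have "H (M - k) = H (M - Suc k) + g (M - k)"
      by (simp only: H_def sum.lessThan_Suc)
    with Suc show ?case by (simp add: algebra_simps)
  qed simp
  show ?thesis
    using assms H[of k] H[of "M - k"] by (simp add: sum_subtractf H_def algebra_simps)
qed

text \<open>
  The quotient \<open>P M / (P k * P (M - k))\<close> is the \<open>w\<close>-binomial coefficient, and \<open>f k\<close> is that
  coefficient up to a sign and a power of \<open>w\<close>. Squaring removes the sign and the halves in the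
  exponent of \<open>w\<close>.
\<close>

lemma q_binomial_square_closed_form:
  fixes w :: "'a::field" and M :: nat
  defines "f \<equiv> \<lambda>k. \<Prod>j<k. (1 - w powi (int j - int M)) / (1 - w ^ Suc j)"
  defines "P \<equiv> \<lambda>k. \<Prod>j<k. 1 - w ^ Suc j"
  assumes w: "w \<noteq> 0" "\<And>j. 0 < j \<Longrightarrow> j \<le> M \<Longrightarrow> w ^ j \<noteq> 1" and k: "k \<le> M"
  shows "f k ^ 2 * w powi (int k * (2 * int M + 1) - int k ^ 2) = (P M / (P k * P (M - k))) ^ 2"
  using k
proof (induction k)
  case 0
  have "P M \<noteq> 0" using w by (auto simp: P_def simp del: power_Suc)
  then show ?case by (simp add: f_def P_def)
next
  case (Suc k)
  define u where "u = 1 - w ^ (M - k)"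
  define v where "v = 1 - w ^ Suc k"
  define e where "e k = int k * (2 * int M + 1) - int k ^ 2" for k
  have nz: "u \<noteq> 0" "v \<noteq> 0" using w(2)[of "M - k"] w(2)[of "Suc k"] Suc.prems
    by (auto simp: u_def v_def simp del: power_Suc)
  have f: "f (Suc k) = f k * (1 - w powi (int k - int M)) / v"
    by (simp add: f_def v_def)
  have "w ^ (M - k) = w powi (int M - int k)"
    using Suc.prems by (simp flip: power_int_of_nat add: of_nat_diff)
  moreover have "w powi (int k - int M) * w powi (int M - int k) = 1"
    using w(1) by (simp flip: power_int_add)
  ultimately have flip: "(1 - w powi (int k - int M)) * w ^ (M - k) = - u"
    by (simp add: u_def left_diff_distrib)
  have e: "e (Suc k) = e k + 2 * (int M - int k)"
    by (simp add: e_def algebra_simps power2_eq_square)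
  have we: "w powi e (Suc k) = w powi e k * (w ^ (M - k)) ^ 2"
  proof -
    have "w powi (2 * (int M - int k)) = (w ^ (M - k)) ^ 2"
      using Suc.prems by (simp add: mult.commute[of 2] power_int_mult flip: of_nat_diff)
    then show ?thesis unfolding e using w(1) by (simp add: power_int_add)
  qed
  have PM: "P (M - k) = P (M - Suc k) * u"
  proof -
    have "M - k = Suc (M - Suc k)" using Suc.prems by simp
    then show ?thesis by (simp only: P_def u_def prod.lessThan_Suc)
  qed
  have Pk: "P (Suc k) = P k * v" by (simp add: P_def v_def)
  have "f (Suc k) ^ 2 * w powi e (Suc k)
      = f k ^ 2 * w powi e k * ((1 - w powi (int k - int M)) * w ^ (M - k)) ^ 2 / v ^ 2"
    unfolding f we by (simp add: power_divide power_mult_distrib)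
  also have "\<dots> = (P M / (P k * P (M - k))) ^ 2 * (u / v) ^ 2"
    unfolding flip using Suc by (simp add: e_def power_divide)
  also have "\<dots> = (P M / (P (Suc k) * P (M - Suc k))) ^ 2"
    unfolding PM Pk using nz by (simp add: power_divide power_mult_distrib)
  finally show ?case by (simp add: e_def)
qed

lemma q_binomial_square_reflection:
  fixes w :: "'a::field" and M :: nat
  defines "f \<equiv> \<lambda>k. \<Prod>j<k. (1 - w powi (int j - int M)) / (1 - w ^ Suc j)"
  assumes w: "w \<noteq> 0" "\<And>j. 0 < j \<Longrightarrow> j \<le> M \<Longrightarrow> w ^ j \<noteq> 1" and k: "k \<le> M"
  shows "f (M - k) ^ 2 = f k ^ 2 * w powi ((int M + 1) * (2 * int k - int M))"
proof -
  define e where "e k = int k * (2 * int M + 1) - int k ^ 2" for k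
  define P where "P k = (\<Prod>j<k. 1 - w ^ Suc j)" for k
  have closed: "f k ^ 2 * w powi e k = (P M / (P k * P (M - k))) ^ 2" if "k \<le> M" for k
    using q_binomial_square_closed_form[OF w that] by (simp only: f_def e_def P_def)
  have "f (M - k) ^ 2 * w powi e (M - k) = f k ^ 2 * w powi e k"
    using closed[of "M - k"] closed[OF k] k by (simp add: mult.commute)
  then have "f (M - k) ^ 2 = f k ^ 2 * w powi (e k - e (M - k))"
    using w(1) by (simp add: power_int_diff field_simps)
  also have "e k - e (M - k) = (int M + 1) * (2 * int k - int M)"
    using k by (simp add: e_def of_nat_diff algebra_simps power2_eq_square)
  finally show ?thesis .
qed

section \<open>The deformed sum and its exact zeros\<close>

locale congruence_parameters =
  fixes d r n :: int
  assumes d: "d \<ge> 3" and r: "r \<le> d - 2" and n: "n \<ge> d - r"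
    and coprime_d_r: "coprime d r" and n_mod: "[n = - r] (mod d)"
begin

text \<open>
  The index of the only factor \<open>1 - q ^ (r + d j)\<close> with \<open>0 \<le> j < n\<close> that vanishes at the
  primitive \<open>n\<close>-th roots of unity, where \<open>r + d M = (d - 1) n\<close>.
\<close>

definition M :: nat where "M = nat (((d - 1) * n - r) div d)"

text \<open>
  The difference between paired parameters: \<open>q ^ (r + n s)\<close> and
  \<open>q ^ (r + n (1 - s)) = a Q ^ (m + 1) / q ^ (r + n s)\<close> with \<open>a = q ^ r\<close> and \<open>Q = q ^ d\<close>.
\<close>

definition m :: nat where "m = nat ((n + r - d) div d)"

lemma d_dvd: "d dvd n + r"
  using n_mod by (simp add: cong_iff_dvd_diff)

lemma M_eq: "d * int M = (d - 1) * n - r"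
proof -
  have "(d - 1) * n - r = d * n - (n + r)" by (simp add: algebra_simps)
  then have dvd: "d dvd (d - 1) * n - r" using d_dvd by (simp only:) simp
  have "(d - 1) * n - r \<ge> (d - 1) * (d - r) - r" using n d by (simp add: mult_left_mono)
  also have "(d - 1) * (d - r) - r = d * (d - 1 - r)" by (simp add: algebra_simps)
  finally have "0 \<le> (d - 1) * n - r" using d r by (smt (verit) mult_nonneg_nonneg)
  then have "int M = ((d - 1) * n - r) div d"
    using d by (simp add: M_def pos_imp_zdiv_nonneg_iff)
  then show ?thesis using dvd by simp
qed

lemma m_eq: "d * int m = n + r - d"
proof -
  have "d dvd n + r - d" using d_dvd by simp
  moreover have "int m = (n + r - d) div d"
    using n d by (simp add: m_def pos_imp_zdiv_nonneg_iff)
  ultimately show ?thesis by simp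
qed

lemma M_plus_m: "int M + int m = n - 1"
proof -
  have "d * (int M + int m) = d * (n - 1)" using M_eq m_eq by (simp add: algebra_simps)
  then show ?thesis using d by simp
qed

text \<open>
  The degree condition for the exact vanishing: \<open>d - 1\<close> pairs give degree \<open>m (d - 1)\<close>, which is
  below \<open>M\<close> exactly because \<open>r \<le> d - 2\<close>, and the excess \<open>d - 1 - r\<close> is the exponent in the last
  factor of the summand.
\<close>

lemma M_eq_m: "int M = int m * (d - 1) + (d - 1 - r)"
proof -
  have "d * int M = d * (int m * (d - 1) + (d - 1 - r))"
    using M_eq m_eq by (simp add: algebra_simps)
  then show ?thesis using d by simp
qed

lemma n_pos: "n \<ge> 2" using n r by simp

lemma coprime_n_d: "coprime n d"
proof (rule coprimeI)
  fix c assume c: "c dvd n" "c dvd d"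
  then have "c dvd n + r" using d_dvd by (blast intro: dvd_trans)
  then have "c dvd r" using c(1) by (simp add: dvd_add_right_iff)
  then show "c dvd 1" using coprime_d_r c(2) by (blast intro: coprime_common_divisor)
qed

lemma not_n_dvd: "0 < i \<Longrightarrow> i < n \<Longrightarrow> \<not> n dvd d * i"
  using coprime_n_d by (auto simp: coprime_dvd_mult_right_iff dest: zdvd_not_zless)

lemma r_shift_nonzero: "r + d * i \<noteq> 0"
proof
  assume "r + d * i = 0"
  then have "d dvd r" by (metis dvd_add_times_triv_right_iff dvd_0_right mult.commute)
  then have "d dvd 1" using coprime_d_r by (metis coprime_common_divisor dvd_refl)
  then show False using d by (auto dest: zdvd_imp_le)
qed

text \<open>
  The quotient \<open>(q ^ r; q ^ d)\<^sub>k / (q ^ d; q ^ d)\<^sub>k\<close>, deformed by \<open>q ^ (n c)\<close> in the well-poised way: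
  the product of the upper parameter and the lower one remains \<open>q ^ (r + d)\<close>.
\<close>

definition pochhammer_ratio :: "'a::field \<Rightarrow> int \<Rightarrow> nat \<Rightarrow> 'a" where
  "pochhammer_ratio z c k = q_shifted_factorial (z powi (r + n * c)) (z powi d) k /
     q_shifted_factorial (z powi (d - n * c)) (z powi d) k"

definition deformed_term :: "'a::field \<Rightarrow> int list \<Rightarrow> nat \<Rightarrow> 'a" where
  "deformed_term z cs k = (1 - z powi (2 * d * int k + r)) * (\<Prod>c\<leftarrow>cs. pochhammer_ratio z c k) *
     z powi (d * (d - 1 - r) * int k)"

text \<open>
  Exponents at which the deformed sum vanishes identically: \<open>0\<close> belongs to the parameter \<open>a\<close>
  itself, \<open>1 - d\<close> makes the parameter equal to \<open>Q ^ (- M)\<close> and terminates the sum, and each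
  \<open>s, 1 - s\<close> gives a Karlsson-Minton pair. For \<open>d - 1\<close> pairs the exponents have sum 0.
\<close>

definition vanishing_point :: "int list \<Rightarrow> int list" where
  "vanishing_point ss = 0 # (1 - d) # concat (map (\<lambda>s. [s, 1 - s]) ss)"

lemma sum_deformed_term_vanishing_point:
  fixes z :: "'a::field"
  assumes z: "z \<noteq> 0" "\<And>i. i \<noteq> 0 \<Longrightarrow> z powi i \<noteq> 1"
    and len: "length ss = nat (d - 1)"
  shows "(\<Sum>k<nat n. deformed_term z (vanishing_point ss) k) = 0"
proof -
  define Q a where "Q = z powi d" and "a = z powi r"
  define es where "es = map (\<lambda>s. z powi (r + n * s)) ss"
  define t where "t = nat (d - 1 - r)"
  have pow: "Q ^ j = z powi (d * int j)" for j
    by (simp add: Q_def power_int_power')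
  have Q: "Q \<noteq> 0" using z(1) by (simp add: Q_def)
  have aQ: "a * Q ^ j = z powi (r + d * int j)" for j
    using z(1) by (simp add: pow a_def power_int_add)
  have QM: "1 / Q ^ M = z powi (r + n * (1 - d))"
  proof -
    have "r + n * (1 - d) = - (d * int M)" using M_eq by (simp add: algebra_simps)
    then show ?thesis by (simp add: pow power_int_minus divide_inverse)
  qed
  have aQM: "a * Q ^ Suc M = z powi (d - n * (1 - d))"
  proof -
    have "r + d * int (Suc M) = d - n * (1 - d)" using M_eq by (simp add: algebra_simps)
    then show ?thesis unfolding aQ by (simp only:)
  qed
  \<comment> \<open>The four parameters that belong to \<open>e = z powi (r + n s)\<close> are those of the quotients with
    exponents \<open>s\<close> and \<open>1 - s\<close>.\<close>
  have e1: "a * Q / z powi (r + n * s) = z powi (d - n * s)" for s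
    using z(1) by (simp add: a_def Q_def power_int_diff power_int_add)
  have e2: "a * Q ^ Suc m / z powi (r + n * s) = z powi (r + n * (1 - s))" for s
  proof -
    have "r + d * int (Suc m) - (r + n * s) = r + n * (1 - s)"
      using m_eq by (simp add: algebra_simps)
    then show ?thesis unfolding aQ using z(1) by (simp flip: power_int_diff)
  qed
  have e3: "z powi (r + n * s) / Q ^ m = z powi (d - n * (1 - s))" for s
  proof -
    have "r + n * s - d * int m = d - n * (1 - s)"
      using m_eq by (simp add: algebra_simps)
    then show ?thesis unfolding pow using z(1) by (simp flip: power_int_diff)
  qed
  have not1: "z powi (d * i - n * s) \<noteq> 1" if "0 < i" "i < n" for i s
    using z(2)[of "d * i - n * s"] not_n_dvd[OF that] by fastforce
  have pair: "pochhammer_ratio z s k * pochhammer_ratio z (1 - s) k =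
      q_shifted_factorial (z powi (r + n * s)) Q k / q_shifted_factorial (a * Q / z powi (r + n * s)) Q k *
        (q_shifted_factorial (a * Q ^ Suc m / z powi (r + n * s)) Q k /
         q_shifted_factorial (z powi (r + n * s) / Q ^ m) Q k)" for s k
    unfolding pochhammer_ratio_def Q_def[symmetric] e1 e2 e3 ..
  have pairs: "(\<Prod>c\<leftarrow>concat (map (\<lambda>s. [s, 1 - s]) ss). pochhammer_ratio z c k) =
      (\<Prod>e\<leftarrow>es. q_shifted_factorial e Q k / q_shifted_factorial (a * Q / e) Q k *
        (q_shifted_factorial (a * Q ^ Suc m / e) Q k / q_shifted_factorial (e / Q ^ m) Q k))" for k
    unfolding es_def
  proof (induction ss)
    case (Cons s ss)
    have "(\<Prod>c\<leftarrow>concat (map (\<lambda>s. [s, 1 - s]) (s # ss)). pochhammer_ratio z c k)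
        = pochhammer_ratio z s k * pochhammer_ratio z (1 - s) k * (\<Prod>c\<leftarrow>concat (map (\<lambda>s. [s, 1 - s]) ss). pochhammer_ratio z c k)"
      by (simp add: mult.assoc)
    then show ?case by (simp only: pair Cons.IH list.map prod_list.Cons)
  qed simp
  have deformed_term: "deformed_term z (vanishing_point ss) k = (1 - a * Q ^ (2 * k)) *
      (q_shifted_factorial a Q k / q_shifted_factorial Q Q k) *
      (q_shifted_factorial (1 / Q ^ M) Q k / q_shifted_factorial (a * Q ^ Suc M) Q k) *
      (\<Prod>e\<leftarrow>es. q_shifted_factorial e Q k / q_shifted_factorial (a * Q / e) Q k *
        (q_shifted_factorial (a * Q ^ Suc m / e) Q k / q_shifted_factorial (e / Q ^ m) Q k)) *
      Q ^ (t * k)" for k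
  proof -
    have "d * (d - 1 - r) * int k = d * int (t * k)" using r by (simp add: t_def)
    then have "z powi (d * (d - 1 - r) * int k) = Q ^ (t * k)" by (simp only: pow)
    moreover have "z powi (2 * d * int k + r) = a * Q ^ (2 * k)"
      unfolding aQ by (simp add: algebra_simps)
    moreover have "pochhammer_ratio z 0 k = q_shifted_factorial a Q k / q_shifted_factorial Q Q k"
      by (simp add: pochhammer_ratio_def a_def Q_def)
    moreover have "pochhammer_ratio z (1 - d) k =
        q_shifted_factorial (1 / Q ^ M) Q k / q_shifted_factorial (a * Q ^ Suc M) Q k"
      unfolding pochhammer_ratio_def QM aQM Q_def[symmetric] ..
    ultimately show ?thesis
      unfolding deformed_term_def vanishing_point_def by (simp only: list.map prod_list.Cons pairs mult.assoc)
  qed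
  have beyond: "deformed_term z (vanishing_point ss) k = 0" if "k > M" for k
  proof -
    have "q_shifted_factorial (1 / Q ^ M) Q k = 0"
      unfolding q_shifted_factorial_def using that Q by (auto intro!: bexI[of _ M])
    then show ?thesis unfolding deformed_term by simp
  qed
  have "(\<Sum>k<nat n. deformed_term z (vanishing_point ss) k) = (\<Sum>k\<le>M. deformed_term z (vanishing_point ss) k)"
    using M_plus_m by (intro sum.mono_neutral_right) (auto intro: beyond)
  also have "\<dots> = 0"
    unfolding deformed_term
  proof (rule karlsson_minton_well_poised_sum_zero)
    show "Q ^ j \<noteq> 1" if "0 < j" for j
      unfolding pow using that d by (intro z(2)) auto
    show "a * Q ^ j \<noteq> 1" for j
      unfolding aQ by (intro z(2) r_shift_nonzero)
    show "M = m * length es + t"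
      using M_eq_m r d by (simp add: es_def len t_def flip: of_nat_eq_iff[where 'a = int])
    show "0 < t" using r by (simp add: t_def)
    fix e assume "e \<in> set es"
    then obtain s where e: "e = z powi (r + n * s)" by (auto simp: es_def)
    show "e \<noteq> 0" using z(1) by (simp add: e)
    fix j assume j: "j < M + m"
    have "a * Q / e * Q ^ j = z powi (d * (int j + 1) - n * s)"
      unfolding e e1 unfolding pow using z(1) by (simp add: algebra_simps flip: power_int_add)
    then show "a * Q / e * Q ^ j \<noteq> 1"
      using not1[of "int j + 1" s] j M_plus_m by simp
    have "e / Q ^ m * Q ^ j = z powi (d * (int j + 1) - n * (1 - s))"
      unfolding e e3 unfolding pow using z(1) by (simp add: algebra_simps flip: power_int_add)
    then show "e / Q ^ m * Q ^ j \<noteq> 1"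
      using not1[of "int j + 1" "1 - s"] j M_plus_m by simp
  qed (use Q in auto)
  finally show ?thesis .
qed

end

section \<open>Expansion of the deformed sum at a primitive root of unity\<close>

lemma fps_nth_0_prod: "(\<Prod>i\<in>A. f i) $ 0 = (\<Prod>i\<in>A. f i $ 0)"
  for f :: "'b \<Rightarrow> 'a::comm_ring_1 fps"
  by (induction A rule: infinite_finite_induct) simp_all

lemma fps_nth_0_sum: "(\<Sum>i\<in>A. f i) $ 0 = (\<Sum>i\<in>A. f i $ 0)"
  for f :: "'b \<Rightarrow> 'a::comm_ring_1 fps"
  by (induction A rule: infinite_finite_induct) simp_all

lemma fps_to_fls_prod: "fps_to_fls (\<Prod>i\<in>A. f i) = (\<Prod>i\<in>A. fps_to_fls (f i))"
  for f :: "'b \<Rightarrow> 'a::comm_ring_1 fps"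
  by (induction A rule: infinite_finite_induct) (simp_all add: fls_times_fps_to_fls)

lemma fps_to_fls_sum: "fps_to_fls (\<Sum>i\<in>A. f i) = (\<Sum>i\<in>A. fps_to_fls (f i))"
  for f :: "'b \<Rightarrow> 'a::comm_ring_1 fps"
  by (induction A rule: infinite_finite_induct) simp_all

lemma fps_to_fls_inverse: "f $ 0 \<noteq> 0 \<Longrightarrow> fps_to_fls (inverse f) = inverse (fps_to_fls f)"
  for f :: "'a::field fps"
  by (simp add: fls_inverse_fps_to_fls)

text \<open>
  The integer powers of \<open>\<zeta> exp h\<close>, as power series.
\<close>

definition q_pow :: "complex \<Rightarrow> int \<Rightarrow> complex fps" where
  "q_pow \<zeta> i = fps_const (\<zeta> powi i) * fps_exp (of_int i)"

lemma q_pow_0 [simp]: "q_pow \<zeta> 0 = 1"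
  by (simp add: q_pow_def)

lemma q_pow_nth_0 [simp]: "q_pow \<zeta> i $ 0 = \<zeta> powi i"
  by (simp add: q_pow_def)

lemma q_pow_add: "\<zeta> \<noteq> 0 \<Longrightarrow> q_pow \<zeta> (i + j) = q_pow \<zeta> i * q_pow \<zeta> j"
proof -
  assume "\<zeta> \<noteq> 0"
  then have "fps_const (\<zeta> powi (i + j)) = fps_const (\<zeta> powi i) * fps_const (\<zeta> powi j)"
    by (simp add: power_int_add)
  then show ?thesis by (simp add: q_pow_def fps_exp_add_mult mult_ac del: fps_const_mult)
qed

lemma q_near_power_int:
  assumes "\<zeta> \<noteq> 0"
  shows "fps_to_fls (q_near \<zeta>) powi i = fps_to_fls (q_pow \<zeta> i)"
proof -
  have nat: "fps_to_fls (q_near \<zeta>) ^ j = fps_to_fls (q_pow \<zeta> (int j))" for j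
  proof (induction j)
    case (Suc j)
    have "q_pow \<zeta> (int (Suc j)) = q_pow \<zeta> 1 * q_pow \<zeta> (int j)"
      using assms by (simp flip: q_pow_add)
    moreover have "q_pow \<zeta> 1 = q_near \<zeta>" by (simp add: q_pow_def q_near_def)
    ultimately show ?case by (simp add: Suc fls_times_fps_to_fls)
  qed simp
  show ?thesis
  proof (cases "i \<ge> 0")
    case True
    then show ?thesis using nat[of "nat i"] by (simp add: power_int_def)
  next
    case False
    have "q_pow \<zeta> (- i) * q_pow \<zeta> i = 1"
      using assms by (simp flip: q_pow_add)
    then have "fps_to_fls (q_pow \<zeta> (- i)) * fps_to_fls (q_pow \<zeta> i) = 1"
      by (simp flip: fls_times_fps_to_fls)
    then have "inverse (fps_to_fls (q_pow \<zeta> (- i))) = fps_to_fls (q_pow \<zeta> i)"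
      by (rule inverse_unique)
    then show ?thesis using False nat[of "nat (- i)"] by (simp add: power_int_def power_inverse)
  qed
qed

lemma q_near_not_root_of_unity:
  assumes "\<zeta> \<noteq> 0" "i \<noteq> 0"
  shows "fps_to_fls (q_near \<zeta>) powi i \<noteq> 1"
proof
  assume "fps_to_fls (q_near \<zeta>) powi i = 1"
  then have "q_pow \<zeta> i = 1"
    using assms by (simp add: q_near_power_int)
  then have "q_pow \<zeta> i $ 1 = 0" by simp
  then show False using assms by (simp add: q_pow_def)
qed

locale congruence_at_root = congruence_parameters +
  fixes \<zeta> :: complex
  assumes primitive: "primitive_root (nat n) \<zeta>"
begin

lemma root_eq_1_iff: "\<zeta> powi i = 1 \<longleftrightarrow> n dvd i"
  using primitive n_pos by (simp add: primitive_root_def)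

lemma root_nonzero: "\<zeta> \<noteq> 0"
  using primitive_root_nonzero[OF _ primitive] n_pos by simp

abbreviation E :: "int \<Rightarrow> complex fps" where "E \<equiv> q_pow \<zeta>"

abbreviation q_loc :: "complex fls" where "q_loc \<equiv> fps_to_fls (q_near \<zeta>)"

lemma E_add_n: "E (i + n * c) = E i * fps_exp (of_int (n * c))"
proof -
  have "\<zeta> powi (n * c) = 1" by (simp add: root_eq_1_iff)
  then show ?thesis
    by (simp add: q_pow_def power_int_add root_nonzero fps_exp_add_mult)
qed

text \<open>
  The deformed quotient at \<open>q = \<zeta> exp h\<close>. The argument \<open>s\<close> stands for \<open>n c\<close>; the deformation is
  \<open>exp (s h)\<close> because \<open>\<zeta> ^ n = 1\<close>, which is what gives \<^const>\<open>log_jet\<close> its meaning here.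
\<close>

definition ratio_series :: "nat \<Rightarrow> int \<Rightarrow> complex fps" where
  "ratio_series k s = (\<Prod>j<k. (1 - E (r + d * int j) * fps_exp (of_int s)) *
     inverse (1 - E (d * int (Suc j)) * fps_exp (of_int (- s))))"

lemma numerator_root_iff: "j < nat n \<Longrightarrow> \<zeta> powi (r + d * int j) = 1 \<longleftrightarrow> j = M"
proof -
  assume j: "j < nat n"
  have "r + d * int j = n * (d - 1) + d * (int j - int M)"
    using M_eq by (simp add: algebra_simps)
  then have "n dvd r + d * int j \<longleftrightarrow> n dvd d * (int j - int M)"
    by (metis dvd_add_right_iff dvd_triv_left)
  also have "\<dots> \<longleftrightarrow> n dvd int j - int M"
    using coprime_n_d by (simp add: coprime_dvd_mult_right_iff)
  also have "\<dots> \<longleftrightarrow> j = M"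
  proof
    assume dvd: "n dvd int j - int M"
    have "\<bar>int j - int M\<bar> < n" using j M_plus_m by auto
    then show "j = M"
      using dvd zdvd_not_zless[of "\<bar>int j - int M\<bar>" n] by (auto simp: zero_less_abs_iff)
  qed simp
  finally show ?thesis by (simp add: root_eq_1_iff)
qed

lemma denominator_not_root: "0 < j \<Longrightarrow> j < nat n \<Longrightarrow> \<zeta> powi (d * int j) \<noteq> 1"
  using not_n_dvd[of "int j"] by (simp add: root_eq_1_iff)

lemma pochhammer_ratio_local:
  assumes k: "k < nat n"
  shows "pochhammer_ratio q_loc c k = fps_to_fls (ratio_series k (n * c))"
proof -
  have "pochhammer_ratio q_loc c k = (\<Prod>j<k. (1 - q_loc powi (r + n * c) * (q_loc powi d) ^ j) /
      (1 - q_loc powi (d - n * c) * (q_loc powi d) ^ j))"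
    by (simp add: pochhammer_ratio_def q_shifted_factorial_def prod_dividef)
  also have "\<dots> = (\<Prod>j<k. fps_to_fls ((1 - E (r + d * int j) * fps_exp (of_int (n * c))) *
     inverse (1 - E (d * int (Suc j)) * fps_exp (of_int (- (n * c))))))"
  proof (rule prod.cong[OF refl])
    fix j assume j: "j \<in> {..<k}"
    have nz: "q_loc \<noteq> 0" by (simp add: q_near_def root_nonzero)
    have "q_loc powi (r + n * c) * (q_loc powi d) ^ j = q_loc powi ((r + d * int j) + n * c)"
      using nz by (simp add: power_int_power' algebra_simps flip: power_int_add)
    then have num: "1 - q_loc powi (r + n * c) * (q_loc powi d) ^ j =
        fps_to_fls (1 - E (r + d * int j) * fps_exp (of_int (n * c)))"
      unfolding q_near_power_int[OF root_nonzero] E_add_n by simp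
    have "q_loc powi (d - n * c) * (q_loc powi d) ^ j = q_loc powi (d * int (Suc j) + n * (- c))"
      using nz by (simp add: power_int_power' algebra_simps flip: power_int_add)
    then have den: "1 - q_loc powi (d - n * c) * (q_loc powi d) ^ j =
        fps_to_fls (1 - E (d * int (Suc j)) * fps_exp (of_int (- (n * c))))"
      unfolding q_near_power_int[OF root_nonzero] E_add_n by simp
    have "(1 - E (d * int (Suc j)) * fps_exp (of_int (- (n * c)))) $ 0 \<noteq> 0"
      using denominator_not_root[of "Suc j"] j k by simp
    then show "(1 - q_loc powi (r + n * c) * (q_loc powi d) ^ j) /
      (1 - q_loc powi (d - n * c) * (q_loc powi d) ^ j) =
      fps_to_fls ((1 - E (r + d * int j) * fps_exp (of_int (n * c))) *
        inverse (1 - E (d * int (Suc j)) * fps_exp (of_int (- (n * c)))))"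
      unfolding num den by (simp only: fls_times_fps_to_fls fps_to_fls_inverse divide_inverse not_False_eq_True)
  qed
  also have "\<dots> = fps_to_fls (ratio_series k (n * c))"
    by (simp only: ratio_series_def fps_to_fls_prod)
  finally show ?thesis .
qed

definition term_series :: "int list \<Rightarrow> nat \<Rightarrow> complex fps" where
  "term_series cs k = (1 - E (2 * d * int k + r)) * (\<Prod>c\<leftarrow>cs. ratio_series k (n * c)) *
     E (d * (d - 1 - r) * int k)"

lemma deformed_term_local:
  assumes k: "k < nat n"
  shows "deformed_term q_loc cs k = fps_to_fls (term_series cs k)"
proof -
  have "(\<Prod>c\<leftarrow>cs. pochhammer_ratio q_loc c k) = fps_to_fls (\<Prod>c\<leftarrow>cs. ratio_series k (n * c))"
    by (induction cs) (simp_all add: pochhammer_ratio_local[OF k] fls_times_fps_to_fls)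
  then show ?thesis
    by (simp add: deformed_term_def term_series_def q_near_power_int root_nonzero fls_times_fps_to_fls)
qed

text \<open>
  The coefficients of orders 1, 3 and 2 in \<open>log_jet_one_minus_exp\<close> are \<open>- odds \<beta>\<close>,
  \<open>log_series3 \<beta>\<close> and \<open>log_series2 \<beta>\<close>. Summed over the factors of a quotient, they give
  its logarithmic coefficients \<open>ratio_log2\<close> and \<open>ratio_log3\<close>; a denominator factor enters with the
  sign of the inverse combined with that of the reflection \<open>s \<mapsto> - s\<close>.
\<close>

definition odds :: "complex fps \<Rightarrow> complex fps" where "odds \<beta> = \<beta> * inverse (1 - \<beta>)"

definition log_series3 :: "complex fps \<Rightarrow> complex fps" where
  "log_series3 \<beta> = - fps_const (1/6) * ((1 + 2 * odds \<beta>) * (odds \<beta> + odds \<beta> ^ 2))"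

definition log_series2 :: "complex fps \<Rightarrow> complex fps" where
  "log_series2 \<beta> = - fps_const (1/2) * (odds \<beta> + odds \<beta> ^ 2)"

lemma log_series3_nth_0:
  "log_series3 \<beta> $ 0 = log_coeff3 (\<beta> $ 0)"
proof -
  have "odds \<beta> $ 0 = \<beta> $ 0 / (1 - \<beta> $ 0)"
    by (simp add: odds_def field_class.field_divide_inverse)
  then show ?thesis
    by (simp add: log_series3_def log_coeff3_def power2_eq_square)
qed

definition base_ratio :: "nat \<Rightarrow> complex fps" where
  "base_ratio k = (\<Prod>j<k. (1 - E (r + d * int j)) * inverse (1 - E (d * int (Suc j))))"

definition ratio_log2 :: "nat \<Rightarrow> complex fps" where
  "ratio_log2 k = (\<Sum>j<k. log_series2 (E (r + d * int j)) - log_series2 (E (d * int (Suc j))))"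

definition ratio_log3 :: "nat \<Rightarrow> complex fps" where
  "ratio_log3 k = (\<Sum>j<k. log_series3 (E (r + d * int j)) + log_series3 (E (d * int (Suc j))))"

lemma log_jet_ratio_series:
  assumes k: "k \<le> M"
  shows "\<exists>l1. log_jet (ratio_series k) (base_ratio k) l1 (ratio_log2 k) (ratio_log3 k)"
proof -
  have lt: "j < nat n" "Suc j < nat n" "j \<noteq> M" if "j < k" for j
    using that k M_plus_m by auto
  have "log_jet (ratio_series k) (base_ratio k)
      (\<Sum>j<k. - odds (E (r + d * int j)) + (- odds (E (d * int (Suc j))))) (ratio_log2 k) (ratio_log3 k)"
    unfolding ratio_series_def base_ratio_def ratio_log2_def ratio_log3_def
  proof (rule log_jet_prod)
    fix j assume j: "j \<in> {..<k}"
    define \<beta> \<gamma> where "\<beta> = E (r + d * int j)" and "\<gamma> = E (d * int (Suc j))"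
    have \<beta>: "\<beta> $ 0 \<noteq> 1" using numerator_root_iff[of j] lt[of j] j by (simp add: \<beta>_def)
    have \<gamma>: "\<gamma> $ 0 \<noteq> 1" using denominator_not_root[of "Suc j"] lt[of j] j by (simp add: \<gamma>_def)
    have num: "log_jet (\<lambda>s. 1 - \<beta> * fps_exp (of_int s)) (1 - \<beta>) (- odds \<beta>) (log_series2 \<beta>) (log_series3 \<beta>)"
      unfolding odds_def log_series2_def log_series3_def by (rule log_jet_one_minus_exp[OF \<beta>])
    have "log_jet (\<lambda>s. 1 - \<gamma> * fps_exp (of_int s)) (1 - \<gamma>) (- odds \<gamma>) (log_series2 \<gamma>) (log_series3 \<gamma>)"
      unfolding odds_def log_series2_def log_series3_def by (rule log_jet_one_minus_exp[OF \<gamma>])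
    from log_jet_inverse[OF log_jet_uminus[OF this]] \<gamma>
    have den: "log_jet (\<lambda>s. inverse (1 - \<gamma> * fps_exp (of_int (- s)))) (inverse (1 - \<gamma>))
        (- odds \<gamma>) (- log_series2 \<gamma>) (log_series3 \<gamma>)"
      by simp
    show "log_jet (\<lambda>s. (1 - \<beta> * fps_exp (of_int s)) * inverse (1 - \<gamma> * fps_exp (of_int (- s))))
      ((1 - \<beta>) * inverse (1 - \<gamma>)) (- odds \<beta> + - odds \<gamma>) (log_series2 \<beta> - log_series2 \<gamma>) (log_series3 \<beta> + log_series3 \<gamma>)"
      using log_jet_mult[OF num den] by simp
  qed
  then show ?thesis by blast
qed

definition base_term :: "nat \<Rightarrow> complex fps" where
  "base_term k = (1 - E (2 * d * int k + r)) * base_ratio k ^ nat (2 * d) * E (d * (d - 1 - r) * int k)"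

lemma term_series_expansion:
  assumes k: "k \<le> M" and len: "length cs = nat (2 * d)" and sum0: "(\<Sum>c\<leftarrow>cs. c) = 0"
  shows "term_series cs k \<approx>\<^sub>4
    base_term k + of_int (\<Sum>c\<leftarrow>cs. c ^ 2) * (fps_X ^ 2 * of_int (n ^ 2) * base_term k * ratio_log2 k)
      + of_int (\<Sum>c\<leftarrow>cs. c ^ 3) * (fps_X ^ 3 * of_int (n ^ 3) * base_term k * ratio_log3 k)"
proof -
  obtain l1 where jet: "log_jet (ratio_series k) (base_ratio k) l1 (ratio_log2 k) (ratio_log3 k)"
    using log_jet_ratio_series[OF k] by blast
  define p2 p3 where "p2 = (\<Sum>c\<leftarrow>cs. c ^ 2)" and "p3 = (\<Sum>c\<leftarrow>cs. c ^ 3)"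
  have p: "(\<Sum>s\<leftarrow>map ((*) n) cs. s) = n * (\<Sum>c\<leftarrow>cs. c)"
      "(\<Sum>s\<leftarrow>map ((*) n) cs. s ^ 2) = n ^ 2 * p2" "(\<Sum>s\<leftarrow>map ((*) n) cs. s ^ 3) = n ^ 3 * p3"
    unfolding p2_def p3_def by (induction cs) (simp_all add: algebra_simps power_mult_distrib)
  have "(\<Prod>c\<leftarrow>cs. ratio_series k (n * c)) = (\<Prod>s\<leftarrow>map ((*) n) cs. ratio_series k s)"
    by (simp add: comp_def)
  also have "\<dots> \<approx>\<^sub>4 base_ratio k ^ nat (2 * d) *
      (1 + fps_X ^ 2 * (ratio_log2 k * of_int (n ^ 2 * p2)) + fps_X ^ 3 * (ratio_log3 k * of_int (n ^ 3 * p3)))"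
    using log_jet_prod_list[OF jet, of "map ((*) n) cs"] unfolding p sum0
    by (simp add: exp_jet_0 len)
  finally have "term_series cs k \<approx>\<^sub>4 (1 - E (2 * d * int k + r)) * (base_ratio k ^ nat (2 * d) *
      (1 + fps_X ^ 2 * (ratio_log2 k * of_int (n ^ 2 * p2)) + fps_X ^ 3 * (ratio_log3 k * of_int (n ^ 3 * p3)))) *
      E (d * (d - 1 - r) * int k)"
    unfolding term_series_def by (intro eqmod_mult eqmod_refl)
  also have "\<dots> = base_term k + of_int p2 * (fps_X ^ 2 * of_int (n ^ 2) * base_term k * ratio_log2 k)
      + of_int p3 * (fps_X ^ 3 * of_int (n ^ 3) * base_term k * ratio_log3 k)"
    by (simp add: base_term_def algebra_simps)
  finally show ?thesis unfolding p2_def p3_def .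
qed

text \<open>
  For \<open>k > M\<close> each of the quotients contains the factor with index \<open>M\<close>, which is divisible
  by \<open>h\<close> for every value of the deformation.
\<close>

lemma term_series_beyond:
  assumes k: "M < k" "k < nat n" and len: "length cs \<ge> 4"
  shows "term_series cs k \<approx>\<^sub>4 0"
proof -
  have "fps_X ^ 1 dvd ratio_series k (n * c)" for c
  proof -
    have "\<zeta> powi (r + d * int M) = 1" using numerator_root_iff[of M] k by simp
    then have "ratio_series k (n * c) $ 0 = 0"
      unfolding ratio_series_def fps_nth_0_prod using k by (intro prod_zero) auto
    then show ?thesis unfolding fps_X_power_dvd_iff by simp
  qed
  then have "fps_X ^ length cs dvd (\<Prod>c\<leftarrow>cs. ratio_series k (n * c))"
    by (induction cs) (auto intro: mult_dvd_mono)
  then have "fps_X ^ 4 dvd (\<Prod>c\<leftarrow>cs. ratio_series k (n * c))"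
    using le_imp_power_dvd[OF len] dvd_trans by blast
  then show ?thesis by (simp add: eqmod_def term_series_def)
qed

section \<open>Antisymmetry of the terms at the root of unity\<close>

lemma root_reflect: "\<zeta> powi (r + d * int j) = (\<zeta> powi d) powi (int j - int M)"
proof -
  have "r + d * int j = n * (d - 1) + d * (int j - int M)"
    using M_eq by (simp add: algebra_simps)
  moreover have "\<zeta> powi (n * (d - 1)) = 1" by (simp add: root_eq_1_iff)
  ultimately show ?thesis
    by (simp add: power_int_add root_nonzero power_int_mult)
qed

text \<open>
  With \<open>w = \<zeta> ^ d\<close> one has \<open>\<zeta> ^ r = w ^ (- M)\<close>, so up to sign and a power of \<open>w\<close> the quotient is
  a \<open>w\<close>-binomial coefficient, which is symmetric under \<open>k \<mapsto> M - k\<close>. The factor \<open>1 - w ^ (2 k - M)\<close> is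
  antisymmetric up to a power of \<open>w\<close>, and the collected powers of \<open>w\<close> cancel since \<open>w ^ n = 1\<close>.
\<close>

lemma base_term_reflect:
  assumes k: "k \<le> M"
  shows "base_term (M - k) $ 0 = - (base_term k $ 0)"
proof -
  define w where "w = \<zeta> powi d"
  define f where "f k = (\<Prod>j<k. (1 - w powi (int j - int M)) / (1 - w ^ Suc j))" for k
  have w0: "w \<noteq> 0" using root_nonzero by (simp add: w_def)
  have w_pow: "\<zeta> powi (d * i) = w powi i" for i by (simp add: w_def power_int_mult)
  have w_n: "w powi (n * i) = 1" for i
    by (simp add: root_eq_1_iff flip: w_pow)
  have w1: "w ^ j \<noteq> 1" if "0 < j" "j \<le> M" for j
    using denominator_not_root[of j] w_pow[of "int j"] that M_plus_m by simp
  have F: "base_ratio k $ 0 = f k" for k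
    unfolding base_ratio_def f_def fps_nth_0_prod
    by (intro prod.cong refl)
      (simp add: root_reflect divide_inverse w_pow del: of_nat_Suc flip: w_def)
  have F_power: "(base_ratio k ^ nat (2 * d)) $ 0 = (f k ^ 2) powi d" for k
  proof -
    have "nat (2 * d) = 2 * nat d" using d by simp
    then show ?thesis using d by (simp add: fps_power_zeroth F power_mult power_int_def)
  qed
  have S: "base_term k $ 0 = (1 - w powi (2 * int k - int M)) * (f k ^ 2) powi d *
      w powi ((d - 1 - r) * int k)" for k
  proof -
    have "\<zeta> powi (2 * d * int k + r) = w powi (2 * int k - int M)"
      using root_reflect[of "2 * k"] by (simp add: algebra_simps w_def)
    moreover have "\<zeta> powi (d * (d - 1 - r) * int k) = w powi ((d - 1 - r) * int k)"
      using w_pow[of "(d - 1 - r) * int k"] by (simp add: mult.assoc)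
    ultimately show ?thesis by (simp add: base_term_def F_power)
  qed
  have f: "f (M - k) ^ 2 = f k ^ 2 * w powi ((int M + 1) * (2 * int k - int M))"
    using q_binomial_square_reflection[OF w0 w1 k] by (simp only: f_def)
  define u where "u = int M - 2 * int k"
  have "base_term (M - k) $ 0 = (1 - w powi u) * ((f k ^ 2) powi d * w powi (- (int M + 1) * u * d)) *
      w powi ((d - 1 - r) * int k + (d - 1 - r) * u)"
  proof -
    have "2 * int (M - k) - int M = u" "(int M + 1) * (2 * int k - int M) = - (int M + 1) * u"
      "(d - 1 - r) * int (M - k) = (d - 1 - r) * int k + (d - 1 - r) * u"
      using k by (simp_all add: u_def of_nat_diff algebra_simps)
    then show ?thesis unfolding S f by (simp only: power_int_mult_distrib power_int_mult)
  qed
  also have "\<dots> = (w powi (- (int M + 1) * u * d) * w powi ((d - 1 - r) * u) * (1 - w powi u)) *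
      (f k ^ 2) powi d * w powi ((d - 1 - r) * int k)"
    using w0 by (simp add: power_int_add)
  also have "w powi (- (int M + 1) * u * d) * w powi ((d - 1 - r) * u) = w powi (- u)"
  proof -
    have "- (int M + 1) * u * d + (d - 1 - r) * u = n * (- (d - 1) * u) + - u"
    proof -
      have "- (int M + 1) * u * d = - ((d * int M + d) * u)" by (simp add: algebra_simps)
      then show ?thesis unfolding M_eq by (simp add: algebra_simps)
    qed
    then have "w powi (- (int M + 1) * u * d) * w powi ((d - 1 - r) * u)
        = w powi (n * (- (d - 1) * u)) * w powi (- u)"
      using w0 by (simp only: power_int_add[symmetric] disjI1 not_False_eq_True)
    then show ?thesis by (simp only: w_n mult_1)
  qed
  also have "w powi (- u) * (1 - w powi u) = - (1 - w powi (- u))"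
    using w0 by (simp add: right_diff_distrib flip: power_int_add)
  also have "- (1 - w powi (- u)) * (f k ^ 2) powi d * w powi ((d - 1 - r) * int k) = - (base_term k $ 0)"
  proof -
    have "- u = 2 * int k - int M" by (simp add: u_def)
    then show ?thesis unfolding S by (simp only: mult_minus_left)
  qed
  finally show ?thesis .
qed

text \<open>
  At \<open>h = 0\<close> the numerator factors are \<open>1 - w ^ (- (M - j))\<close>, so by \<open>log_coeff3_inverse\<close> their third
  coefficients are those of the denominator factors in reverse order.
\<close>

lemma ratio_log3_reflect:
  assumes k: "k \<le> M"
  shows "ratio_log3 (M - k) $ 0 = ratio_log3 k $ 0"
proof -
  define g where "g j = log_coeff3 (\<zeta> powi (d * int j))" for j
  have "ratio_log3 k $ 0 = (\<Sum>j<k. g (Suc j) - g (M - j))" if "k \<le> M" for k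
    unfolding ratio_log3_def fps_nth_0_sum
  proof (intro sum.cong refl)
    fix j assume "j \<in> {..<k}"
    then have j: "j < M" using that by simp
    have lt: "j < nat n" "Suc j < nat n" "j \<noteq> M" "M - j < nat n" using j M_plus_m by auto
    have "\<zeta> powi (r + d * int j) = inverse (\<zeta> powi (d * int (M - j)))"
      unfolding root_reflect using j
      by (simp add: of_nat_diff right_diff_distrib flip: power_int_minus power_int_mult)
    then have "log_coeff3 (\<zeta> powi (r + d * int j)) = - g (M - j)"
      using denominator_not_root[of "M - j"] lt j root_nonzero by (simp add: g_def log_coeff3_inverse)
    then show "(log_series3 (E (r + d * int j)) + log_series3 (E (d * int (Suc j)))) $ 0 = g (Suc j) - g (M - j)"
      using numerator_root_iff[of j] denominator_not_root[of "Suc j"] lt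
      by (simp add: log_series3_nth_0 g_def del: of_nat_Suc)
  qed
  then show ?thesis using sum_reflection_difference[OF k, of g] k by simp
qed

text \<open>
  An antisymmetric function of \<open>k\<close> times a symmetric one has sum 0.
\<close>

lemma sum_base_term_ratio_log3: "fps_X dvd (\<Sum>k\<le>M. base_term k * ratio_log3 k)"
proof -
  define A where "A = (\<Sum>k\<le>M. base_term k $ 0 * ratio_log3 k $ 0)"
  have "A = (\<Sum>k\<le>M. base_term (M - k) $ 0 * ratio_log3 (M - k) $ 0)"
    unfolding A_def by (intro sum.reindex_bij_witness[of _ "\<lambda>k. M - k" "\<lambda>k. M - k"]) auto
  also have "\<dots> = - A"
    unfolding A_def sum_negf[symmetric] by (intro sum.cong refl) (simp add: base_term_reflect ratio_log3_reflect)
  finally have "A = 0" by simp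
  then have "(\<Sum>k\<le>M. base_term k * ratio_log3 k) $ 0 = 0" by (simp add: fps_nth_0_sum A_def)
  then have "fps_X ^ 1 dvd (\<Sum>k\<le>M. base_term k * ratio_log3 k)" unfolding fps_X_power_dvd_iff by simp
  then show ?thesis by simp
qed

section \<open>Vanishing to fourth order\<close>

text \<open>
  The cubic term has the factor \<open>h ^ 3\<close>, and the remaining sum is divisible by \<open>h\<close>. Hence,
  modulo \<open>h ^ 4\<close>, the deformed sum depends on the exponents only through the sum of their squares,
  and this dependence is affine.
\<close>

lemma sum_term_series_expansion:
  assumes len: "length cs = nat (2 * d)" and sum0: "(\<Sum>c\<leftarrow>cs. c) = 0"
  shows "(\<Sum>k<nat n. term_series cs k) \<approx>\<^sub>4
    (\<Sum>k\<le>M. base_term k) + of_int (\<Sum>c\<leftarrow>cs. c ^ 2) * (\<Sum>k\<le>M. fps_X ^ 2 * of_int (n ^ 2) * base_term k * ratio_log2 k)"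
proof -
  define p2 p3 where "p2 = (\<Sum>c\<leftarrow>cs. c ^ 2)" and "p3 = (\<Sum>c\<leftarrow>cs. c ^ 3)"
  let ?g = "\<lambda>k. base_term k + of_int p2 * (fps_X ^ 2 * of_int (n ^ 2) * base_term k * ratio_log2 k)
      + of_int p3 * (fps_X ^ 3 * of_int (n ^ 3) * base_term k * ratio_log3 k)"
  have "(\<Sum>k<nat n. term_series cs k) \<approx>\<^sub>4 (\<Sum>k<nat n. if k \<le> M then ?g k else 0)"
  proof (rule eqmod_sum)
    fix k assume k: "k \<in> {..<nat n}"
    show "term_series cs k \<approx>\<^sub>4 (if k \<le> M then ?g k else 0)"
    proof (cases "k \<le> M")
      case True
      then show ?thesis
        unfolding p2_def p3_def using term_series_expansion[OF True len sum0] by (simp only: if_True)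
    next
      case False
      then show ?thesis
        using term_series_beyond[of k cs] k len d by simp
    qed
  qed
  also have "(\<Sum>k<nat n. if k \<le> M then ?g k else 0) = (\<Sum>k\<le>M. ?g k)"
    using M_plus_m by (intro sum.mono_neutral_cong_right) auto
  also have "\<dots> = (\<Sum>k\<le>M. base_term k) + of_int p2 * (\<Sum>k\<le>M. fps_X ^ 2 * of_int (n ^ 2) * base_term k * ratio_log2 k)
      + of_int p3 * of_int (n ^ 3) * (fps_X ^ 3 * (\<Sum>k\<le>M. base_term k * ratio_log3 k))"
    by (simp add: sum.distrib sum_distrib_left mult_ac)
  also have "\<dots> \<approx>\<^sub>4 (\<Sum>k\<le>M. base_term k) + of_int p2 * (\<Sum>k\<le>M. fps_X ^ 2 * of_int (n ^ 2) * base_term k * ratio_log2 k)"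
  proof -
    have "fps_X ^ 4 dvd fps_X ^ 3 * (\<Sum>k\<le>M. base_term k * ratio_log3 k)"
      using sum_base_term_ratio_log3 mult_dvd_mono[of "fps_X ^ 3" "fps_X ^ 3" fps_X "\<Sum>k\<le>M. base_term k * ratio_log3 k"]
      by (simp add: numeral_eq_Suc mult_ac)
    then show ?thesis by (simp add: eqmod_def)
  qed
  finally show ?thesis unfolding p2_def p3_def .
qed

text \<open>
  The deformed sum vanishes for \<open>s = 1, \<dots>, 1\<close> and for \<open>s = 2, 1, \<dots>, 1\<close>, where the sums of
  squares differ by the unit 4. An affine function with two zeros at this distance vanishes
  modulo \<open>h ^ 4\<close>.
\<close>

lemma sum_deformed_term_origin:
  "\<exists>f. (\<Sum>k<nat n. deformed_term q_loc (replicate (nat (2 * d)) 0) k) = fps_to_fls (fps_X ^ 4 * f)"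
proof -
  define A where "A = (\<Sum>k\<le>M. base_term k)"
  define B where "B = (\<Sum>k\<le>M. fps_X ^ 2 * of_int (n ^ 2) * base_term k * ratio_log2 k)"
  define T where "T cs = (\<Sum>k<nat n. term_series cs k)" for cs
  define p2 where "p2 cs = (\<Sum>c\<leftarrow>cs. c ^ 2)" for cs :: "int list"
  have T: "(\<Sum>k<nat n. deformed_term q_loc cs k) = fps_to_fls (T cs)" for cs
    by (simp add: T_def fps_to_fls_sum deformed_term_local)
  have expand: "T cs \<approx>\<^sub>4 A + of_int (p2 cs) * B" if "length cs = nat (2 * d)" "sum_list cs = 0" for cs
    using sum_term_series_expansion[of cs] that by (simp add: T_def A_def B_def p2_def)
  have zero: "A + of_int (p2 (vanishing_point ss)) * B \<approx>\<^sub>4 0"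
    if "length ss = nat (d - 1)" for ss
  proof -
    have "fps_to_fls (T (vanishing_point ss)) = 0"
      unfolding T[symmetric] using that root_nonzero
      by (intro sum_deformed_term_vanishing_point q_near_not_root_of_unity) (auto simp: q_near_def)
    then have "T (vanishing_point ss) = 0" by simp
    moreover have "length (vanishing_point ss) = nat (2 * d)"
    proof -
      have "length (concat (map (\<lambda>s. [s, 1 - s]) ss)) = 2 * length ss" by (induction ss) auto
      then show ?thesis using that d by (simp add: vanishing_point_def)
    qed
    moreover have "sum_list (vanishing_point ss) = 0"
    proof -
      have "sum_list (concat (map (\<lambda>s. [s, 1 - s]) ss)) = int (length ss)" by (induction ss) auto
      then show ?thesis using that d by (simp add: vanishing_point_def)
    qed
    ultimately show ?thesis using expand[of "vanishing_point ss"] eqmod_sym by metis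
  qed
  \<comment> \<open>Both lists have length \<open>d - 1\<close>.\<close>
  define s1 s2 where "s1 = replicate (nat (d - 1)) (1::int)" and "s2 = 2 # replicate (nat (d - 2)) (1::int)"
  have p2_rep: "sum_list (map power2 (concat (replicate k [1, 0 :: int]))) = int k" for k
    by (induction k) auto
  have "p2 (vanishing_point s1) = (1 - d) ^ 2 + (d - 1)"
    using d by (simp add: p2_def vanishing_point_def s1_def p2_rep)
  moreover have "p2 (vanishing_point s2) = (1 - d) ^ 2 + 5 + (d - 2)"
    using d by (simp add: p2_def vanishing_point_def s2_def p2_rep)
  ultimately have "p2 (vanishing_point s2) = p2 (vanishing_point s1) + 4" by simp
  moreover have 1: "fps_X ^ 4 dvd A + of_int (p2 (vanishing_point s1)) * B"
    using zero[of s1] by (simp add: s1_def eqmod_def)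
  moreover have "fps_X ^ 4 dvd A + of_int (p2 (vanishing_point s2)) * B"
    using zero[of s2] d by (simp add: s2_def eqmod_def)
  ultimately have "fps_X ^ 4 dvd (A + of_int (p2 (vanishing_point s1) + 4) * B) - (A + of_int (p2 (vanishing_point s1)) * B)"
    by (metis dvd_diff)
  then have "fps_X ^ 4 dvd 4 * B" by (simp add: algebra_simps)
  then have "fps_X ^ 4 dvd fps_const (1/4) * (4 * B)" by (rule dvd_mult)
  moreover have "fps_const (1/4) * (4 * B) = B" by (simp add: numeral_fps_const flip: mult.assoc)
  ultimately have "fps_X ^ 4 dvd B" by simp
  with 1 have "fps_X ^ 4 dvd A" by (metis dvd_add_left_iff dvd_mult)
  moreover have "T (replicate (nat (2 * d)) 0) \<approx>\<^sub>4 A"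
    using expand[of "replicate (nat (2 * d)) 0"] by (simp add: p2_def sum_list_replicate)
  ultimately have "fps_X ^ 4 dvd T (replicate (nat (2 * d)) 0)"
    unfolding eqmod_def by (metis dvd_add_right_iff diff_add_cancel)
  then show ?thesis unfolding T by (auto elim!: dvdE)
qed

end

theorem theorem1:
  fixes d r n :: int
  assumes "d \<ge> 3" and "r \<le> d - 2" and "n \<ge> d - r"
    and "coprime d r" and "[n = - r] (mod d)"
  shows "fract_cong
    (\<Sum>k = 0..<nat n.
       q_integer q_var (2 * d * int k + r) *
       (q_shifted_factorial (q_var powi r) (q_var powi d) k powi (2 * d) /
        q_shifted_factorial (q_var powi d) (q_var powi d) k powi (2 * d)) *
       q_var powi (d * (d - 1 - r) * int k))
    0 (cyclotomic (nat n) ^ 4)"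
    (is "fract_cong ?S _ _")
proof (rule fract_cong_0_cyclotomic_power)
  interpret congruence_parameters d r n
    using assms by unfold_locales
  show "nat n > 0" using n_pos by simp
  fix \<zeta> :: complex
  assume prim: "primitive_root (nat n) \<zeta>"
  interpret congruence_at_root d r n \<zeta>
    using prim by unfold_locales
  interpret transcendental_point q_loc
    by (rule transcendental_q_near[OF root_nonzero])
  obtain f where f: "(\<Sum>k<nat n. deformed_term q_loc (replicate (nat (2 * d)) 0) k) = fps_to_fls (fps_X ^ 4 * f)"
    using sum_deformed_term_origin by blast
  have "eval_fract q_loc ?S = (\<Sum>k<nat n. deformed_term q_loc (replicate (nat (2 * d)) 0) k / (1 - q_loc))"
    unfolding eval_fract_sum atLeast0LessThan
  proof (intro sum.cong refl)
    fix k
    have "(\<Prod>c\<leftarrow>replicate (nat (2 * d)) 0. pochhammer_ratio q_loc c k) = pochhammer_ratio q_loc 0 k powi (2 * d)"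
      using d by (simp add: power_int_def)
    then show "eval_fract q_loc (q_integer q_var (2 * d * int k + r) *
       (q_shifted_factorial (q_var powi r) (q_var powi d) k powi (2 * d) /
        q_shifted_factorial (q_var powi d) (q_var powi d) k powi (2 * d)) *
       q_var powi (d * (d - 1 - r) * int k)) = deformed_term q_loc (replicate (nat (2 * d)) 0) k / (1 - q_loc)"
      by (simp add: deformed_term_def q_integer_def q_shifted_factorial_def pochhammer_ratio_def
        power_int_divide_distrib prod_dividef)
  qed
  also have "\<dots> = fps_to_fls (fps_X ^ 4 * f) / (1 - q_loc)"
    unfolding f[symmetric] by (rule sum_divide_distrib[symmetric])
  also have "\<dots> = fps_to_fls (fps_X ^ 4 * (f * inverse (1 - q_near \<zeta>)))"
  proof -
    have "\<zeta> \<noteq> 1" using root_eq_1_iff[of 1] n_pos by auto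
    then have "(1 - q_near \<zeta>) $ 0 \<noteq> 0" by (simp add: q_near_def)
    from fps_to_fls_inverse[OF this] show ?thesis
      by (simp add: fls_times_fps_to_fls divide_inverse mult.assoc)
  qed
  finally show "\<exists>f. eval_fract q_loc ?S = fps_to_fls (fps_X ^ 4 * f)" by blast
qed

end
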